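(* Continuous zero-parity (ZP) information distinguishes internal from external visibility edges. That is, let $\mathcal P,\mathcal Q:[0,1]\to\mathbb R^2$ be two admissible curves with the same continuous ZP information, i.e. $B^{\mathcal P}_s(t)=B^{\mathcal Q}_s(t)$, $T^{\mathcal P}_s(t)=T^{\mathcal Q}_s(t)$ and $H^{\mathcal P}_s(t)=H^{\mathcal Q}_s(t)$ for all parameters $s,t$ representing distinct points. Then for all such $s,t$ with $B^{\mathcal P}_s(t)=z$ (equivalently $B^{\mathcal Q}_s(t)=z$), the pair $(s,t)$ is an I-edge for $\mathcal P$ if and only if it is an I-edge for $\mathcal Q$.
   Context: An admissible curve is a (closed) Jordan curve $\mathcal P:[0,1]\to\mathbb R^2$ (so $\mathcal P(0)=\mathcal P(1)$ and $\mathcal P$ is otherwise injective), parameterized by $t\in[0,1]$ in counterclockwise direction, that is piecewise algebraic, smooth except at finitely many points, and has nonzero curvature everywhere (so that every line meets the curve in finitely many points). Parameters are taken cyclically ($0$ and $1$ identified). For parameters $s,t$ with $x=\mathcal P(s)\neq y=\mathcal P(t)$, let $L$ be the line through $x$ and $y$. Let $\mathrm{Body}(x,y)$, $\mathrm{Tail}(x,y)$, $\mathrm{Head}(x,y)$ be the number of points of the curve lying, respectively, on the open segment between $x$ and $y$, on the open ray of $L$ ending at $x$ and not containing $y$, and on the open ray of $L$ starting at $y$ and not containing $x$. The zero-parity of a nonnegative integer is $z$ if it is $0$, $o$ if it is odd, and $e$ if it is even and positive. Define $B_s(t),T_s(t),H_s(t)\in\{z,o,e\}$ as the zero-parities of $\mathrm{Body}(x,y)$,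 $\mathrm{Tail}(x,y)$, $\mathrm{Head}(x,y)$; superscripts $\mathcal P$, $\mathcal Q$ indicate the curve. The continuous ZP information of $\mathcal P$ is the collection of all these functions over all $s$. The pair $(s,t)$ is a visibility edge if $B_s(t)=z$; then the open segment $xy$ is disjoint from the curve, and the pair is an I-edge (internal) if this open segment lies in the interior of the Jordan curve, and an E-edge (external) if it lies in the exterior. *)

theory Defs
  imports "HOL-Complex_Analysis.Complex_Analysis" "HOL-Computational_Algebra.Polynomial"
begin

text \<open>The plane is represented by \<^typ>\<open>complex\<close>, where the library provides Jordan curves
  (\<^const>\<open>simple_path\<close>, \<^const>\<open>inside\<close>) and winding numbers. A curve is a function on the reals of
  which only the values on [0,1] matter.\<close>

text \<open>Parameters are cyclic, so smoothness and curvature at the seam (parameters 0 and 1) are those of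
  the 1-periodic extension.\<close>

definition cyclic :: "(real \<Rightarrow> complex) \<Rightarrow> real \<Rightarrow> complex" where
  "cyclic P t = P (frac t)"

definition vderiv :: "(real \<Rightarrow> complex) \<Rightarrow> real \<Rightarrow> complex" where
  "vderiv f t = vector_derivative f (at t)"

text \<open>A smooth point of a parameterized curve: infinitely often differentiable near \<open>t\<close>, with nonzero
  velocity at \<open>t\<close>.\<close>

definition smooth_point :: "(real \<Rightarrow> complex) \<Rightarrow> real \<Rightarrow> bool" where
  "smooth_point f t \<longleftrightarrow>
     (\<exists>U. open U \<and> t \<in> U \<and> (\<forall>n. \<forall>u\<in>U. (vderiv ^^ n) f differentiable at u)) \<and>
     vderiv f t \<noteq> 0"

text \<open>Signed curvature \<open>(x' y'' - y' x'') / |f'|^3\<close> of \<open>f = x + i y\<close>.\<close>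

definition curvature :: "(real \<Rightarrow> complex) \<Rightarrow> real \<Rightarrow> real" where
  "curvature f t =
     (Re (vderiv f t) * Im (vderiv (vderiv f) t) - Im (vderiv f t) * Re (vderiv (vderiv f) t))
       / norm (vderiv f t) ^ 3"

text \<open>Bivariate polynomials are polynomials in \<open>y\<close> with coefficients in \<open>\<real>[x]\<close>.\<close>

definition poly2 :: "real poly poly \<Rightarrow> real \<Rightarrow> real \<Rightarrow> real" where
  "poly2 F x y = poly (poly F [:y:]) x"

definition algebraic_arc :: "(real \<Rightarrow> complex) \<Rightarrow> real \<Rightarrow> real \<Rightarrow> bool" where
  "algebraic_arc P a b \<longleftrightarrow> (\<exists>F. F \<noteq> 0 \<and> (\<forall>t\<in>{a..b}. poly2 F (Re (P t)) (Im (P t)) = 0))"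

definition piecewise_algebraic :: "(real \<Rightarrow> complex) \<Rightarrow> bool" where
  "piecewise_algebraic P \<longleftrightarrow>
     (\<exists>(n::nat) (k :: nat \<Rightarrow> real). k 0 = 0 \<and> k n = 1 \<and>
        (\<forall>i<n. k i < k (Suc i) \<and> algebraic_arc P (k i) (k (Suc i))))"

text \<open>Curvature is required to be nonzero at every smooth point; at the finitely many other points it
  is not defined. That every line meets such a curve in finitely many points is a consequence, not
  an additional requirement.\<close>

definition admissible_curve :: "(real \<Rightarrow> complex) \<Rightarrow> bool" where
  "admissible_curve P \<longleftrightarrow>
     simple_path P \<and> pathfinish P = pathstart P \<and>
     (\<forall>w\<in>inside (path_image P). winding_number P w = 1) \<and>
     piecewise_algebraic P \<and>
     finite {t \<in> {0..<1}. \<not> smooth_point (cyclic P) t} \<and>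
     (\<forall>t\<in>{0..<1}. smooth_point (cyclic P) t \<longrightarrow> curvature (cyclic P) t \<noteq> 0)"

text \<open>The open ray of the line through \<open>x\<close> and \<open>y\<close> that starts at \<open>y\<close> and does not contain \<open>x\<close>.\<close>

definition open_ray_beyond :: "complex \<Rightarrow> complex \<Rightarrow> complex set" where
  "open_ray_beyond x y = {y + r *\<^sub>R (y - x) | r. 0 < r}"

definition Body :: "(real \<Rightarrow> complex) \<Rightarrow> complex \<Rightarrow> complex \<Rightarrow> nat" where
  "Body P x y = card (path_image P \<inter> open_segment x y)"

definition Tail :: "(real \<Rightarrow> complex) \<Rightarrow> complex \<Rightarrow> complex \<Rightarrow> nat" where
  "Tail P x y = card (path_image P \<inter> open_ray_beyond y x)"

definition Head :: "(real \<Rightarrow> complex) \<Rightarrow> complex \<Rightarrow> complex \<Rightarrow> nat" where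
  "Head P x y = card (path_image P \<inter> open_ray_beyond x y)"

datatype zero_parity = ZP_zero | ZP_odd | ZP_even

definition zero_parity_of :: "nat \<Rightarrow> zero_parity" where
  "zero_parity_of n = (if n = 0 then ZP_zero else if odd n then ZP_odd else ZP_even)"

definition B_info :: "(real \<Rightarrow> complex) \<Rightarrow> real \<Rightarrow> real \<Rightarrow> zero_parity" where
  "B_info P s t = zero_parity_of (Body P (P s) (P t))"

definition T_info :: "(real \<Rightarrow> complex) \<Rightarrow> real \<Rightarrow> real \<Rightarrow> zero_parity" where
  "T_info P s t = zero_parity_of (Tail P (P s) (P t))"

definition H_info :: "(real \<Rightarrow> complex) \<Rightarrow> real \<Rightarrow> real \<Rightarrow> zero_parity" where
  "H_info P s t = zero_parity_of (Head P (P s) (P t))"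

text \<open>For simple closed curves \<open>P s \<noteq> P t\<close> and \<open>Q s \<noteq> Q t\<close> are the same condition on \<open>s\<close> and \<open>t\<close>.\<close>

definition same_ZP_info :: "(real \<Rightarrow> complex) \<Rightarrow> (real \<Rightarrow> complex) \<Rightarrow> bool" where
  "same_ZP_info P Q \<longleftrightarrow>
     (\<forall>s\<in>{0..1}. \<forall>t\<in>{0..1}. P s \<noteq> P t \<and> Q s \<noteq> Q t \<longrightarrow>
        B_info P s t = B_info Q s t \<and> T_info P s t = T_info Q s t \<and> H_info P s t = H_info Q s t)"

definition visibility_edge :: "(real \<Rightarrow> complex) \<Rightarrow> real \<Rightarrow> real \<Rightarrow> bool" where
  "visibility_edge P s t \<longleftrightarrow> B_info P s t = ZP_zero"

definition I_edge :: "(real \<Rightarrow> complex) \<Rightarrow> real \<Rightarrow> real \<Rightarrow> bool" where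
  "I_edge P s t \<longleftrightarrow>
     visibility_edge P s t \<and> open_segment (P s) (P t) \<subseteq> inside (path_image P)"

end

theory Submission imports Defs begin

text \<open>For fixed \<open>s\<close> and all but countably many \<open>t\<close>, the line through
  \<open>P s\<close> and \<open>P t\<close> crosses the curve transversally at all its other points on the ray from \<open>P s\<close>
  through \<open>P t\<close>. For such a visibility edge, each crossing beyond the midpoint switches between the
  interior and the exterior, so the edge is internal iff Head is even. Any visibility edge
  \<open>(s, t)\<close> of \<open>P\<close> is a limit of visibility edges \<open>(s', t')\<close> generic for both \<open>P\<close> and \<open>Q\<close>, because
  near \<open>(s, t)\<close> there is an \<open>s'\<close> with uncountably many \<open>t'\<close> visible from it. The midpoint of a
  visibility edge is off the curve, so its side does not change under small perturbations.\<close>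

subsection \<open>The planar cross product\<close>

text \<open>Head counts points without multiplicity, so at a tangency or a corner it may count a
  point where the curve does not change sides. This is why a single sight line is not enough and
  generic ones are needed. Nonzero curvature makes the bad lines rare: at a tangency seen from a
  fixed point \<open>c\<close>, the derivative of \<open>cross (D u) (P u - c)\<close> is a nonzero
  multiple of the curvature numerator, so such parameters are isolated, hence countable.
  Algebraicity together with curvature makes every line meet the curve finitely often, so each bad
  point spoils only finitely many \<open>t\<close>. The two curves share nothing but their
  parameters. A perturbation built from the geometry of \<open>P\<close> therefore gives no control
  over the tangencies of \<open>Q\<close>. What remains possible is a cardinality argument: for one
  fixed \<open>s'\<close>, uncountably many visible \<open>t'\<close> cannot all be bad for
  \<open>P\<close> or bad for \<open>Q\<close>.\<close>

definition cross :: "complex \<Rightarrow> complex \<Rightarrow> real" where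
  "cross a b = Im (cnj a * b)"

lemma cross_eq: "cross a b = Re a * Im b - Im a * Re b"
  by (simp add: cross_def)

lemma cross_simps [simp]:
  "cross a (b + c) = cross a b + cross a c" "cross (a + b) c = cross a c + cross b c"
  "cross a (b - c) = cross a b - cross a c" "cross (a - b) c = cross a c - cross b c"
  "cross a (- b) = - cross a b" "cross (- a) b = - cross a b"
  "cross (r *\<^sub>R a) b = r * cross a b" "cross a (r *\<^sub>R b) = r * cross a b"
  "cross (of_real r * a) b = r * cross a b" "cross a (of_real r * b) = r * cross a b"
  "cross a a = 0" "cross a 0 = 0" "cross 0 a = 0"
  by (simp_all add: cross_eq algebra_simps)

lemma bounded_bilinear_cross: "bounded_bilinear cross"
proof
  show "\<exists>K. \<forall>a b. norm (cross a b) \<le> norm a * norm b * K"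
    by (rule exI[of _ 1]) (metis abs_Im_le_cmod cross_def complex_mod_cnj mult.right_neutral norm_mult real_norm_def)
qed (simp_all add: cross_eq algebra_simps)

lemmas continuous_on_cross [continuous_intros] = bounded_bilinear.continuous_on [OF bounded_bilinear_cross]
lemmas tendsto_cross [tendsto_intros] = bounded_bilinear.tendsto [OF bounded_bilinear_cross]

lemma abs_cross_le: "\<bar>cross a b\<bar> \<le> norm a * norm b"
  by (metis abs_Im_le_cmod cross_def complex_mod_cnj norm_mult)

lemma cross_eq_0_imp_parallel:
  assumes "cross d z = 0" "d \<noteq> 0"
  obtains r where "z = r *\<^sub>R d"
proof -
  have "Im (z / d) = 0"
    using assms by (simp add: cross_eq Im_divide algebra_simps)
  then have "z / d = of_real (Re (z / d))" by (simp add: complex_eq_iff)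
  then have "z = Re (z / d) *\<^sub>R d" using assms(2) by (simp add: scaleR_conv_of_real field_simps)
  then show ?thesis by (rule that)
qed

lemma has_real_derivative_cross:
  assumes "(f has_vector_derivative f') (at t)" "(g has_vector_derivative g') (at t)"
  shows "((\<lambda>u. cross (f u) (g u)) has_real_derivative (cross (f t) g' + cross f' (g t))) (at t)"
  using bounded_bilinear.has_vector_derivative [OF bounded_bilinear_cross assms]
  by (simp add: has_real_derivative_iff_has_vector_derivative)

lemma has_real_derivative_cross_const:
  assumes "(g has_vector_derivative g') (at t)"
  shows "((\<lambda>u. cross d (g u - c)) has_real_derivative cross d g') (at t)"
  using has_real_derivative_cross [of "\<lambda>_. d" 0 t "\<lambda>u. g u - c" g'] assms
  by (simp add: has_vector_derivative_diff_const)

subsection \<open>Bivariate polynomials on a line\<close>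

lemma poly2_pCons: "poly2 (pCons p F) x y = poly p x + y * poly2 F x y"
  by (simp add: poly2_def)

lemma poly2_0 [simp]: "poly2 0 x y = 0" by (simp add: poly2_def)
lemma poly2_add: "poly2 (F + G) x y = poly2 F x y + poly2 G x y" by (simp add: poly2_def)
lemma poly2_mult: "poly2 (F * G) x y = poly2 F x y * poly2 G x y" by (simp add: poly2_def)
lemma poly2_smult: "poly2 (smult p G) x y = poly p x * poly2 G x y" by (simp add: poly2_def)
lemma poly2_power: "poly2 (F ^ k) x y = poly2 F x y ^ k" by (simp add: poly2_def)

lemma continuous_on_poly2 [continuous_intros]:
  assumes "continuous_on S f" "continuous_on S g"
  shows "continuous_on S (\<lambda>u. poly2 F (f u) (g u))"
  by (induction F) (auto simp: poly2_pCons intro!: continuous_intros assms)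

text \<open>This makes an arbitrary line a coordinate axis. The substitution passes through Horner's
  scheme, first for the coefficients in \<open>x\<close>, then for the polynomial in
  \<open>y\<close>.\<close>

lemma poly2_affine_substitution:
  obtains G where "\<And>r w. poly2 G r w = poly2 F (a1 + a2 * r + a3 * w) (b1 + b2 * r + b3 * w)"
proof -
  have one: "\<exists>G. \<forall>r w. poly2 G r w = poly p (a1 + a2 * r + a3 * w)" for p :: "real poly"
  proof (induction p)
    case 0 then show ?case by (intro exI[of _ 0]) auto
  next
    case (pCons a p)
    then obtain G where G: "\<forall>r w. poly2 G r w = poly p (a1 + a2 * r + a3 * w)" by auto
    \<comment> \<open>With \<open>r\<close> as the inner and \<open>w\<close> as the outer variable,
      \<open>[:[:a1, a2:], [:a3:]:]\<close> is the linear form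
      \<open>a1 + a2 * r + a3 * w\<close>.\<close>
    show ?case
      by (rule exI[of _ "[:[:a:]:] + [:[:a1, a2:], [:a3:]:] * G"])
        (simp add: poly2_add poly2_mult poly2_smult G poly2_pCons algebra_simps)
  qed
  have "\<exists>G. \<forall>r w. poly2 G r w = poly2 F (a1 + a2 * r + a3 * w) (b1 + b2 * r + b3 * w)"
  proof (induction F)
    case 0 then show ?case by (intro exI[of _ 0]) auto
  next
    case (pCons p F)
    then obtain G where G: "\<forall>r w. poly2 G r w = poly2 F (a1 + a2 * r + a3 * w) (b1 + b2 * r + b3 * w)" by auto
    obtain H where H: "\<forall>r w. poly2 H r w = poly p (a1 + a2 * r + a3 * w)" using one by blast
    show ?case
      by (rule exI[of _ "H + [:[:b1, b2:], [:b3:]:] * G"])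
        (simp add: poly2_add poly2_mult poly2_smult G H poly2_pCons algebra_simps)
  qed
  then show ?thesis using that by blast
qed

text \<open>Otherwise every constant \<open>[:y:]\<close> would be a root of the nonzero polynomial
  \<open>F\<close> over the domain of polynomials in \<open>x\<close>.\<close>

lemma poly2_all_0_imp_0:
  assumes "\<And>x y. poly2 F x y = 0"
  shows "F = 0"
proof (rule ccontr)
  assume "F \<noteq> 0"
  have "poly F [:y:] = 0" for y
    using assms by (metis poly2_def poly_all_0_iff_0)
  then have "range (\<lambda>y::real. [:y:]) \<subseteq> {q. poly F q = 0}" by auto
  moreover have "infinite (range (\<lambda>y::real. [:y:]))"
    by (metis (no_types, lifting) finite_imageD infinite_UNIV_char_0 inj_onI pCons_eq_iff)
  ultimately show False using poly_roots_finite[OF \<open>F \<noteq> 0\<close>] finite_subset by blast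
qed

text \<open>In coordinates \<open>(r, w)\<close> along and across the line, \<open>F\<close> becomes \<open>w ^ k * G\<close> with \<open>G\<close> not
  divisible by \<open>w\<close>.\<close>

lemma poly2_line_factor:
  assumes "F \<noteq> 0" "d \<noteq> 0"
  obtains G k where "poly G 0 \<noteq> 0"
    "\<And>r w. poly2 F (Re (c + r *\<^sub>R d + w *\<^sub>R (\<i> * d))) (Im (c + r *\<^sub>R d + w *\<^sub>R (\<i> * d))) = w ^ k * poly2 G r w"
proof -
  obtain H where H: "\<And>r w. poly2 H r w = poly2 F (Re c + Re d * r + (- Im d) * w) (Im c + Im d * r + Re d * w)"
    using poly2_affine_substitution[of F "Re c" "Re d" "- Im d" "Im c" "Im d" "Re d"] by metis
  have "H \<noteq> 0"
  proof
    assume "H = 0"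
    have "poly2 F x y = 0" for x y
    proof -
      define r where "r = Re ((Complex x y - c) / d)"
      define w where "w = Im ((Complex x y - c) / d)"
      have "Complex x y = c + (Complex r w) * d" using assms(2) by (simp add: r_def w_def)
      then have "x = Re c + Re d * r + (- Im d) * w" "y = Im c + Im d * r + Re d * w"
        by (simp_all add: complex_eq_iff algebra_simps)
      then show ?thesis using H[of r w] \<open>H = 0\<close> by simp
    qed
    then show False using poly2_all_0_imp_0 assms(1) by blast
  qed
  \<comment> \<open>\<open>H\<close> is read as a polynomial in \<open>w\<close> whose coefficients
    are polynomials in \<open>r\<close>; its root 0 has finite order.\<close>
  then obtain G where G: "H = [:- 0, 1:] ^ order 0 H * G" "\<not> [:- 0, 1:] dvd G"
    using order_decomp by blast
  have x: "poly2 [:0, 1:] r w = w" for r w by (simp add: poly2_def)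
  show ?thesis
  proof (rule that[of G "order 0 H"])
    show "poly G 0 \<noteq> 0" using G(2) by (simp add: poly_eq_0_iff_dvd)
    fix r w
    have "poly2 H r w = w ^ order 0 H * poly2 G r w"
      by (subst G(1)) (simp add: poly2_mult poly2_power x)
    then show "poly2 F (Re (c + r *\<^sub>R d + w *\<^sub>R (\<i> * d))) (Im (c + r *\<^sub>R d + w *\<^sub>R (\<i> * d))) = w ^ order 0 H * poly2 G r w"
      using H[of r w] by (simp add: algebra_simps)
  qed
qed

subsection \<open>Piecewise smooth curves of nonzero curvature\<close>

text \<open>\<open>E\<close> holds the non-smooth parameters and the seam. With 0 and 1 in
  \<open>E\<close>, the regular parameters form an open set, two-sided derivatives of
  \<open>P\<close> make sense there, and no other parameter in [0,1] gives the same point as a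
  regular one.\<close>

locale curved_loop =
  fixes P :: "real \<Rightarrow> complex" and E :: "real set" and D D2 :: "real \<Rightarrow> complex"
  assumes simple: "simple_path P" and loop: "pathfinish P = pathstart P"
    and finite_E: "finite E" and seam: "0 \<in> E" "1 \<in> E"
    and D: "t \<in> {0..1} - E \<Longrightarrow> (P has_vector_derivative D t) (at t)"
    and D2: "t \<in> {0..1} - E \<Longrightarrow> (D has_vector_derivative D2 t) (at t)"
    and curved: "t \<in> {0..1} - E \<Longrightarrow> cross (D t) (D2 t) \<noteq> 0"
begin

lemma P_eqD: "P u = P v \<Longrightarrow> u \<in> {0..1} \<Longrightarrow> v \<in> {0..1} \<Longrightarrow> u = v \<or> u = 0 \<and> v = 1 \<or> u = 1 \<and> v = 0"
  using simple unfolding simple_path_def loop_free_def by blast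

lemma P01: "P 1 = P 0"
  using loop by (simp add: pathfinish_def pathstart_def)

lemma continuous_P: "continuous_on {0..1} P"
  using simple simple_path_imp_path path_def by blast

lemma open_regular: "open ({0..1} - E)"
proof -
  have "{0..1} - E = {0<..<1} - E" using seam by (auto simp: less_le)
  then show ?thesis using finite_E by (simp add: finite_imp_closed open_Diff)
qed

lemma finite_vimage_P:
  assumes "finite S"
  shows "finite {u \<in> {0..1}. P u \<in> S}"
proof -
  have "finite (P -` S \<inter> {0<..<1})"
    using finite_vimage_IntI[OF assms simple_path_inj_on[OF simple]] .
  moreover have "{u \<in> {0..1}. P u \<in> S} \<subseteq> (P -` S \<inter> {0<..<1}) \<union> {0, 1}" by force
  ultimately show ?thesis by (meson finite.emptyI finite.insertI finite_UnI finite_subset)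
qed

text \<open>On an arc inside a line with direction \<open>d\<close>, the velocity and the
  acceleration are both parallel to \<open>d\<close> at regular parameters, so the curvature would
  vanish there.\<close>

lemma no_straight_arc:
  assumes "\<alpha> < \<beta>" "{\<alpha><..<\<beta>} \<subseteq> {0..1}" "d \<noteq> 0" and flat: "\<And>u. u \<in> {\<alpha><..<\<beta>} \<Longrightarrow> cross d (P u - c) = 0"
  shows False
proof -
  define W where "W = {\<alpha><..<\<beta>} - E"
  have W: "open W" "W \<subseteq> {0..1} - E"
    using assms(2) finite_E by (auto simp: W_def finite_imp_closed open_Diff)
  have "infinite {\<alpha><..<\<beta>}" using assms(1) by simp
  then have "W \<noteq> {}" unfolding W_def using finite_E by (metis Diff_infinite_finite finite.emptyI)
  then obtain v where v: "v \<in> W" by blast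
  have D0: "cross d (D u) = 0" if "u \<in> W" for u
  proof (rule DERIV_unique)
    show "((\<lambda>u. cross d (P u - c)) has_real_derivative cross d (D u)) (at u)"
      using that W D by (intro has_real_derivative_cross_const) auto
    show "((\<lambda>u. cross d (P u - c)) has_real_derivative 0) (at u)"
      by (rule has_field_derivative_transform_within_open[OF _ W(1) that, of "\<lambda>_. 0"])
        (use flat in \<open>auto simp: W_def\<close>)
  qed
  have "cross d (D2 v) = 0"
  proof (rule DERIV_unique)
    show "((\<lambda>u. cross d (D u - 0)) has_real_derivative cross d (D2 v)) (at v)"
      using v W D2 by (intro has_real_derivative_cross_const) auto
    show "((\<lambda>u. cross d (D u - 0)) has_real_derivative 0) (at v)"
      by (rule has_field_derivative_transform_within_open[OF _ W(1) v, of "\<lambda>_. 0"])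
        (use D0 in auto)
  qed
  then have "cross (D v) (D2 v) = 0"
    using D0[OF v] assms(3) by (metis cross_eq_0_imp_parallel cross_simps(7,8,11) mult_zero_right)
  then show False using curved v W(2) by blast
qed

text \<open>The line itself may be a component of the zero set of \<open>F\<close>, so restricting
  \<open>F\<close> to it may give zero. After splitting off \<open>w ^ k\<close>, the restriction of
  \<open>G\<close> is a nonzero polynomial in \<open>r\<close>. If an intersection point were not a
  root of it, \<open>G\<close> would be nonzero nearby, forcing \<open>w = 0\<close> on a whole arc,
  against \<open>no_straight_arc\<close>.\<close>

lemma finite_line_algebraic_arc:
  assumes alg: "algebraic_arc P a b" and ab: "0 \<le> a" "a < b" "b \<le> 1" and "d \<noteq> 0"
  shows "finite {u \<in> {a..b}. cross d (P u - c) = 0}"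
proof -
  obtain F where F: "F \<noteq> 0" "\<And>u. u \<in> {a..b} \<Longrightarrow> poly2 F (Re (P u)) (Im (P u)) = 0"
    using alg unfolding algebraic_arc_def by blast
  obtain G k where G0: "poly G 0 \<noteq> 0" and
    G: "\<And>r w. poly2 F (Re (c + r *\<^sub>R d + w *\<^sub>R (\<i> * d))) (Im (c + r *\<^sub>R d + w *\<^sub>R (\<i> * d))) = w ^ k * poly2 G r w"
    using poly2_line_factor[OF F(1) \<open>d \<noteq> 0\<close>, of c] by metis
  define r where "r = (\<lambda>u. Re ((P u - c) / d))"
  define w where "w = (\<lambda>u. Im ((P u - c) / d))"
  have P_eq: "P u = c + r u *\<^sub>R d + w u *\<^sub>R (\<i> * d)" for u
  proof -
    have "P u - c = Complex (r u) (w u) * d" using \<open>d \<noteq> 0\<close> by (simp add: r_def w_def)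
    then show ?thesis by (simp add: complex_eq_iff algebra_simps)
  qed
  have w_eq: "cross d (P u - c) = 0 \<longleftrightarrow> w u = 0" for u
  proof -
    have "cross d (P u - c) = w u * (norm d)\<^sup>2"
      by (subst P_eq) (simp add: cross_eq cmod_power2, simp add: algebra_simps power2_eq_square)
    then show ?thesis using \<open>d \<noteq> 0\<close> by simp
  qed
  have cont: "continuous_on {a..b} (\<lambda>u. poly2 G (r u) (w u))"
    unfolding r_def w_def using ab \<open>d \<noteq> 0\<close>
    by (intro continuous_intros) (auto intro: continuous_on_subset[OF continuous_P])
  have wh: "w u ^ k * poly2 G (r u) (w u) = 0" if "u \<in> {a..b}" for u
    using G[of "r u" "w u"] F(2)[OF that] P_eq[of u] by simp
  have roots: "poly (poly G 0) (r u) = 0" if u: "u \<in> {a..b}" "w u = 0" for u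
  proof (rule ccontr)
    assume "poly (poly G 0) (r u) \<noteq> 0"
    then have "poly2 G (r u) (w u) \<noteq> 0" using u by (simp add: poly2_def)
    then obtain e where e: "e > 0" "\<And>v. v \<in> {a..b} \<Longrightarrow> dist u v < e \<Longrightarrow> poly2 G (r v) (w v) \<noteq> 0"
      using continuous_on_avoid[OF cont u(1)] by metis
    have flat: "cross d (P v - c) = 0" if "v \<in> {a..b}" "dist u v < e" for v
      using e(2)[OF that] wh[OF that(1)] by (intro w_eq[THEN iffD2]) simp
    show False
    proof (cases "u < b")
      case True
      show False
        by (rule no_straight_arc[of u "min b (u + e)" d c])
          (use True e(1) ab u \<open>d \<noteq> 0\<close> in \<open>auto intro!: flat[simplified] simp: dist_real_def\<close>)
    next
      case False
      show False
        by (rule no_straight_arc[of "max a (u - e)" u d c])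
          (use False e(1) ab u \<open>d \<noteq> 0\<close> in \<open>auto intro!: flat[simplified] simp: dist_real_def\<close>)
    qed
  qed
  have "finite {u \<in> {0..1}. P u \<in> (\<lambda>r. c + r *\<^sub>R d) ` {r. poly (poly G 0) r = 0}}"
    by (intro finite_vimage_P finite_imageI poly_roots_finite G0)
  moreover have "{u \<in> {a..b}. cross d (P u - c) = 0} \<subseteq> {u \<in> {0..1}. P u \<in> (\<lambda>r. c + r *\<^sub>R d) ` {r. poly (poly G 0) r = 0}}"
  proof
    fix u assume u: "u \<in> {u \<in> {a..b}. cross d (P u - c) = 0}"
    then have "w u = 0" using w_eq by simp
    then have "P u = c + r u *\<^sub>R d" using P_eq[of u] by simp
    then show "u \<in> {u \<in> {0..1}. P u \<in> (\<lambda>r. c + r *\<^sub>R d) ` {r. poly (poly G 0) r = 0}}"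
      using u ab roots \<open>w u = 0\<close> by auto
  qed
  ultimately show ?thesis by (rule rev_finite_subset)
qed

lemma finite_line_piecewise_algebraic:
  assumes "piecewise_algebraic P" "d \<noteq> 0"
  shows "finite {u \<in> {0..1}. cross d (P u - c) = 0}"
proof -
  obtain n :: nat and k :: "nat \<Rightarrow> real" where k: "k 0 = 0" "k n = 1"
    and kk: "\<And>i. i < n \<Longrightarrow> k i < k (Suc i)" "\<And>i. i < n \<Longrightarrow> algebraic_arc P (k i) (k (Suc i))"
    using assms(1) unfolding piecewise_algebraic_def by blast
  have lo: "0 \<le> k i" if "i \<le> n" for i
    using that by (induction i) (use k kk(1) in \<open>auto simp: Suc_le_eq intro: order.trans less_imp_le\<close>)
  have "finite {u \<in> {0..k i}. cross d (P u - c) = 0} \<and> k i \<le> 1" if "i \<le> n" for i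
  proof -
    have hi: "k i \<le> 1" if "i \<le> n" for i
      using that by (induction rule: inc_induct) (use k kk(1) in \<open>auto intro: order.trans less_imp_le\<close>)
    have "finite {u \<in> {0..k i}. cross d (P u - c) = 0}"
      using that
    proof (induction i)
      case 0
      have "finite {0..k 0}" by (simp add: k)
      then show ?case by (rule rev_finite_subset) auto
    next
      case (Suc i)
      have "finite {u \<in> {k i..k (Suc i)}. cross d (P u - c) = 0}"
        using Suc.prems by (intro finite_line_algebraic_arc kk lo hi assms) auto
      moreover have "{u \<in> {0..k (Suc i)}. cross d (P u - c) = 0} \<subseteq>
        {u \<in> {0..k i}. cross d (P u - c) = 0} \<union> {u \<in> {k i..k (Suc i)}. cross d (P u - c) = 0}" by auto
      ultimately show ?case using Suc by (meson Suc_leD finite_UnI finite_subset)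
    qed
    then show ?thesis using hi that by blast
  qed
  then show ?thesis using k(2) by (metis order_refl)
qed

end

text \<open>Algebraicity enters the rest of the proof only through
  \<open>finite_line\<close>.\<close>

locale tame_loop = curved_loop +
  assumes finite_line: "d \<noteq> 0 \<Longrightarrow> finite {u \<in> {0..1}. cross d (P u - c) = 0}"

lemma admissible_curve_tame_loop:
  assumes "admissible_curve P"
  obtains E D D2 where "tame_loop P E D D2"
proof -
  define f where "f = cyclic P"
  define E where "E = {0, 1} \<union> {t \<in> {0..<1}. \<not> smooth_point f t}"
  have smooth: "smooth_point f t" "0 < t" "t < 1" if "t \<in> {0..1} - E" for t
    using that by (auto simp: E_def)
  have diff: "(f has_vector_derivative vderiv f t) (at t)"
    "(vderiv f has_vector_derivative vderiv (vderiv f) t) (at t)" if t: "t \<in> {0..1} - E" for t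
  proof -
    obtain U where "t \<in> U" "\<forall>n. \<forall>u\<in>U. (vderiv ^^ n) f differentiable at u"
      using smooth(1)[OF t] unfolding smooth_point_def by blast
    then have "(vderiv ^^ 0) f differentiable at t" "(vderiv ^^ 1) f differentiable at t" by blast+
    then show "(f has_vector_derivative vderiv f t) (at t)"
      "(vderiv f has_vector_derivative vderiv (vderiv f) t) (at t)"
      by (simp_all add: vderiv_def[abs_def] vector_derivative_works)
  qed
  have loop: "curved_loop P E (vderiv f) (vderiv (vderiv f))"
  proof
    show "simple_path P" "pathfinish P = pathstart P" "finite E" "0 \<in> E" "1 \<in> E"
      using assms unfolding admissible_curve_def E_def f_def by auto
    fix t assume t: "t \<in> {0..1} - E"
    show "(P has_vector_derivative vderiv f t) (at t)"
      by (rule has_vector_derivative_transform_within_open[OF diff(1)[OF t], of "{0<..<1}"])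
        (use smooth[OF t] in \<open>auto simp: f_def cyclic_def frac_eq\<close>)
    show "(vderiv f has_vector_derivative vderiv (vderiv f) t) (at t)" by (rule diff(2)[OF t])
    have "curvature f t \<noteq> 0"
      using assms smooth[OF t] unfolding admissible_curve_def f_def by auto
    then show "cross (vderiv f t) (vderiv (vderiv f) t) \<noteq> 0"
      by (auto simp: curvature_def cross_eq)
  qed
  then interpret curved_loop P E "vderiv f" "vderiv (vderiv f)" .
  have "piecewise_algebraic P" using assms unfolding admissible_curve_def by blast
  then have "tame_loop P E (vderiv f) (vderiv (vderiv f))"
    by unfold_locales (rule finite_line_piecewise_algebraic)
  then show ?thesis by (rule that)
qed

subsection \<open>Isolated points and flips on the real line\<close>

text \<open>Assigning to each point of \<open>A\<close> a member of a countable base that isolates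
  it is injective.\<close>

lemma countable_isolated_reals:
  fixes A :: "real set"
  assumes "\<And>a. a \<in> A \<Longrightarrow> eventually (\<lambda>b. b \<notin> A) (at a)"
  shows "countable A"
proof -
  obtain B :: "real set set" where B: "countable B" "\<And>X. X \<in> B \<Longrightarrow> open X"
    "\<And>S. open S \<Longrightarrow> \<exists>U. U \<subseteq> B \<and> S = \<Union>U"
    using univ_second_countable by blast
  have "\<exists>X\<in>B. X \<inter> A = {a}" if a: "a \<in> A" for a
  proof -
    obtain S where S: "open S" "a \<in> S" "\<And>b. b \<in> S \<Longrightarrow> b \<noteq> a \<Longrightarrow> b \<notin> A"
      using assms[OF a] unfolding eventually_at_topological by blast
    obtain X where "X \<in> B" "a \<in> X" "X \<subseteq> S" using B(3)[OF S(1)] S(2) by blast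
    then show ?thesis using S(3) a by blast
  qed
  then obtain X where X: "\<And>a. a \<in> A \<Longrightarrow> X a \<in> B \<and> X a \<inter> A = {a}" by metis
  have "inj_on X A" by (rule inj_onI) (metis X singleton_inject)
  moreover have "countable (X ` A)" using X B(1) by (meson countable_subset image_subsetI)
  ultimately show ?thesis using countable_image_inj_on by blast
qed

text \<open>\<open>I r\<close> will say whether the point at position \<open>r\<close> on a ray is
  interior. It fails beyond \<open>M\<close>; coming back from there, each point of \<open>A\<close>
  toggles it. The induction is on the number of points of \<open>A\<close> still ahead of
  \<open>r\<close>.\<close>

lemma parity_of_flips:
  fixes I :: "real \<Rightarrow> bool"
  assumes "finite A"
    and const: "\<And>p q. r0 \<le> p \<Longrightarrow> p < q \<Longrightarrow> {p..q} \<inter> A = {} \<Longrightarrow> I p = I q"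
    and flip: "\<And>a. a \<in> A \<Longrightarrow> \<exists>e>0. \<forall>r. 0 < r \<longrightarrow> r < e \<longrightarrow> I (a + r) \<noteq> I (a - r)"
    and far: "\<And>r. M < r \<Longrightarrow> \<not> I r"
    and "r0 \<le> r" "r \<notin> A"
  shows "I r \<longleftrightarrow> odd (card {a \<in> A. r < a})"
  using assms(5,6)
proof (induction "card {a \<in> A. r < a}" arbitrary: r)
  case 0
  then have no: "{a \<in> A. r < a} = {}" using assms(1) by simp
  define q where "q = max r M + 1"
  have "{r..q} \<inter> A = {}"
  proof -
    have "a \<noteq> r" "\<not> r < a" if "a \<in> A" for a using no 0(3) that by auto
    then show ?thesis by force
  qed
  moreover have "r < q" by (simp add: q_def)
  ultimately have "I r = I q" using const 0(2) by blast
  moreover have "\<not> I q" by (rule far) (simp add: q_def)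
  ultimately show ?case using no by (metis card.empty even_zero)
next
  case (Suc n)
  define B where "B = {a \<in> A. r < a}"
  have B: "finite B" "B \<noteq> {}" using Suc(2) assms(1) by (auto simp: B_def simp del: Collect_empty_eq)
  define a where "a = Min B"
  have a: "a \<in> A" "r < a" using Min_in[OF B] by (auto simp: a_def B_def)
  have min: "a \<le> b" if "b \<in> A" "r < b" for b using that B by (simp add: a_def B_def)
  obtain e where e: "e > 0" "\<And>r. 0 < r \<Longrightarrow> r < e \<Longrightarrow> I (a + r) \<noteq> I (a - r)" using flip a(1) by blast
  obtain e' where e': "e' > 0" "\<And>b. b \<in> A \<Longrightarrow> b \<noteq> a \<Longrightarrow> e' \<le> dist a b"
    using finite_set_avoid[OF assms(1), of a] by blast
  \<comment> \<open>Small enough to use the flip at \<open>a\<close>, to avoid every other point of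
    \<open>A\<close>, and to keep \<open>a - x\<close> beyond \<open>r\<close>.\<close>
  define x where "x = Min {e, e', a - r} / 2"
  have "Min {e, e', a - r} > 0" using e(1) e'(1) a(2) by (subst Min_gr_iff) auto
  moreover have "Min {e, e', a - r} \<le> e" "Min {e, e', a - r} \<le> e'" "Min {e, e', a - r} \<le> a - r"
    by (auto intro!: Min_le)
  ultimately have x: "0 < x" "x < e" "x < e'" "x < a - r" unfolding x_def by linarith+
  have above: "{b \<in> A. a + x < b} = B - {a}"
  proof -
    have "a + x < b" if "b \<in> A" "r < b" "b \<noteq> a" for b
      using min[OF that(1,2)] e'(2)[OF that(1,3)] x(3) by (simp add: dist_real_def)
    then show ?thesis using x a by (auto simp: B_def)
  qed
  have "{r..a - x} \<inter> A = {}"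
  proof -
    have "b \<noteq> r" if "b \<in> A" for b using that Suc.prems by blast
    then show ?thesis using min x by force
  qed
  then have "I r = I (a - x)" using const[of r "a - x"] Suc.prems x by auto
  moreover have "I (a + x) = odd (card {b \<in> A. a + x < b})"
  proof (rule Suc.hyps(1))

    show "n = card {b \<in> A. a + x < b}" using above Suc(2) B a by (simp add: B_def)
    show "r0 \<le> a + x" using Suc.prems a x by linarith
    show "a + x \<notin> A" using e'(2)[of "a + x"] x by (auto simp: dist_real_def)
  qed
  moreover have "card B = Suc (card (B - {a}))"
    using B a by (metis B_def card.remove mem_Collect_eq)
  ultimately show ?case using e(2)[OF x(1,2)] above by (simp add: B_def)
qed

subsection \<open>Transversal crossings\<close>

context curved_loop
begin

abbreviation S where "S \<equiv> path_image P"

lemma P_in_S: "u \<in> {0..1} \<Longrightarrow> P u \<in> S"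
  by (simp add: path_image_def)

lemma closed_S: "closed S" and compact_S: "compact S"
  using simple simple_path_imp_path closed_path_image compact_path_image by blast+

text \<open>By the Jordan curve theorem the frontier of the interior is the curve, and a connected
  set that meets both a set and its complement meets its frontier.\<close>

lemma inside_const:
  assumes "connected T" "T \<inter> S = {}" "a \<in> T" "b \<in> T"
  shows "a \<in> inside S \<longleftrightarrow> b \<in> inside S"
proof -
  have "inside S \<inter> T = {} \<or> T \<subseteq> inside S"
  proof (rule ccontr)
    assume "\<not> ?thesis"
    then have "T \<inter> inside S \<noteq> {}" "T - inside S \<noteq> {}" by auto
    then have "T \<inter> frontier (inside S) \<noteq> {}" by (rule connected_Int_frontier[OF assms(1)])
    then show False using assms(2) Jordan_inside_outside[OF simple loop] by auto
  qed
  then show ?thesis using assms(3,4) by auto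
qed

text \<open>The parameters at distance at least \<open>\<delta>\<close> from \<open>u\<close> have a
  compact image, and it misses \<open>P u\<close> because a regular \<open>u\<close> is not the
  seam.\<close>

lemma near_parameter:
  assumes "u \<in> {0..1} - E" "\<delta> > 0"
  obtains \<epsilon> where "\<epsilon> > 0" "\<And>v. v \<in> {0..1} \<Longrightarrow> dist (P u) (P v) < \<epsilon> \<Longrightarrow> \<bar>v - u\<bar> < \<delta>"
proof -
  define K where "K = {0..1} - ball u \<delta>"
  have "compact K" unfolding K_def by (intro compact_diff) auto
  then have "compact (P ` K)"
    using continuous_on_subset[OF continuous_P] by (intro compact_continuous_image) (auto simp: K_def)
  moreover have "P u \<notin> P ` K"
  proof
    assume "P u \<in> P ` K"
    then obtain v where "v \<in> {0..1}" "v \<noteq> u" "P u = P v" using assms(2) unfolding K_def image_iff by force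
    then show False using P_eqD[of u v] assms(1) seam by auto
  qed
  ultimately obtain \<epsilon> where e: "\<epsilon> > 0" "\<And>z. z \<in> P ` K \<Longrightarrow> \<epsilon> \<le> dist (P u) z"
    using separate_point_closed compact_imp_closed by metis
  show ?thesis
  proof (rule that[OF e(1)])
    fix v assume "v \<in> {0..1}" "dist (P u) (P v) < \<epsilon>"
    then show "\<bar>v - u\<bar> < \<delta>" using e(2)[of "P v"] by (force simp: K_def dist_real_def)
  qed
qed

text \<open>Where \<open>P u - c\<close> is parallel to \<open>D u\<close>, the derivative of
  \<open>cross (D u) (P u - c)\<close> reduces to \<open>cross (D2 u) (P u - c)\<close>, a nonzero
  multiple of \<open>cross (D u) (D2 u)\<close>. Hence the zeros are isolated.\<close>

lemma countable_tangents_from: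
  "countable {u \<in> {0..1} - E. P u \<noteq> c \<and> cross (D u) (P u - c) = 0}"
proof (rule countable_isolated_reals)
  fix u assume u: "u \<in> {u \<in> {0..1} - E. P u \<noteq> c \<and> cross (D u) (P u - c) = 0}"
  let ?g = "\<lambda>v. cross (D v) (P v - c)"
  have uE: "u \<in> {0..1} - E" using u by blast
  have "(?g has_real_derivative (cross (D u) (D u) + cross (D2 u) (P u - c))) (at u)"
  proof (rule has_real_derivative_cross[OF D2[OF uE]])
    show "((\<lambda>v. P v - c) has_vector_derivative D u) (at u)"
      using D[OF uE] by (simp add: has_vector_derivative_diff_const)
  qed
  then have g': "(?g has_real_derivative cross (D2 u) (P u - c)) (at u)" by simp
  have "D u \<noteq> 0" using curved[OF uE] by auto
  then obtain r where r: "P u - c = r *\<^sub>R D u" using u cross_eq_0_imp_parallel by blast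
  have "cross (D2 u) (D u) = - cross (D u) (D2 u)" by (simp add: cross_eq)
  moreover have "r \<noteq> 0" using r u by auto
  moreover have "cross (D2 u) (P u - c) = r * cross (D2 u) (D u)" unfolding r by simp
  ultimately have "cross (D2 u) (P u - c) \<noteq> 0" using curved[OF uE] by simp
  then have "eventually (\<lambda>v. ?g v \<noteq> ?g u) (at u)"
  proof -
    have "((\<lambda>v. (?g v - ?g u) / (v - u)) \<longlongrightarrow> cross (D2 u) (P u - c)) (at u)"
      using g' by (simp add: has_field_derivative_iff)
    from tendsto_imp_eventually_ne[OF this \<open>cross (D2 u) (P u - c) \<noteq> 0\<close>]
    show ?thesis by (rule eventually_mono) auto
  qed
  then show "eventually (\<lambda>v. v \<notin> {u \<in> {0..1} - E. P u \<noteq> c \<and> cross (D u) (P u - c) = 0}) (at u)"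
    by (rule eventually_mono) (use u in auto)
qed

text \<open>Near \<open>P u\<close> the curve stays in a double cone about its tangent that excludes
  the direction \<open>d\<close>. \<open>near_parameter\<close> ensures that every curve point close
  to \<open>P u\<close> has a parameter close to \<open>u\<close>, where the linear approximation
  applies.\<close>

lemma transversal_cone:
  assumes u: "u \<in> {0..1} - E" and c: "cross d (D u) \<noteq> 0"
  obtains \<epsilon> \<kappa> where "\<epsilon> > 0" "\<kappa> > 0" "\<And>z. z \<in> S \<Longrightarrow> dist (P u) z < \<epsilon> \<Longrightarrow> \<kappa> * dist (P u) z \<le> \<bar>cross d (z - P u)\<bar>"
proof -
  define a where "a = \<bar>cross d (D u)\<bar>"
  have a: "a > 0" using c by (simp add: a_def)
  \<comment> \<open>The allowed linearization error: after multiplication by \<open>norm d\<close>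
    it is at most half of the transversal speed \<open>a\<close>.\<close>
  define e where "e = a / (2 * (norm d + 1))"
  have e: "e > 0" using a by (simp add: e_def add_nonneg_pos)
  have de: "norm d * e \<le> a / 2"
  proof -
    have "norm d * e = (norm d / (norm d + 1)) * (a / 2)" by (simp add: e_def)
    also have "\<dots> \<le> 1 * (a / 2)" using a by (intro mult_right_mono) (auto simp: divide_le_eq_1 add_nonneg_pos)
    finally show ?thesis by simp
  qed
  obtain \<delta> where \<delta>: "\<delta> > 0" "\<And>v. norm (v - u) < \<delta> \<Longrightarrow> norm (P v - P u - (v - u) *\<^sub>R D u) \<le> e * norm (v - u)"
    using D[OF u] e unfolding has_vector_derivative_def has_derivative_at_alt by blast
  obtain \<epsilon> where \<epsilon>: "\<epsilon> > 0" "\<And>v. v \<in> {0..1} \<Longrightarrow> dist (P u) (P v) < \<epsilon> \<Longrightarrow> \<bar>v - u\<bar> < \<delta>"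
    using near_parameter[OF u \<delta>(1)] by metis
  \<comment> \<open>The ratio of the lower bound \<open>a / 2\<close> for the transversal
    displacement to the upper bound \<open>norm (D u) + e\<close> for the whole displacement, both
    per unit of \<open>\<bar>v - u\<bar>\<close>.\<close>
  define \<kappa> where "\<kappa> = (a / 2) / (norm (D u) + e)"
  have \<kappa>: "\<kappa> > 0" using a e by (simp add: \<kappa>_def add_nonneg_pos)
  show ?thesis
  proof (rule that[OF \<epsilon>(1) \<kappa>])
    fix z assume z: "z \<in> S" "dist (P u) z < \<epsilon>"
    then obtain v where v: "v \<in> {0..1}" "z = P v" by (auto simp: path_image_def)
    define R where "R = P v - P u - (v - u) *\<^sub>R D u"
    have R: "norm R \<le> e * \<bar>v - u\<bar>"
      using \<delta>(2)[of v] \<epsilon>(2)[of v] v z by (simp add: R_def)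
    have Pv: "P v - P u = (v - u) *\<^sub>R D u + R" by (simp add: R_def)
    have "norm (P v - P u) \<le> \<bar>v - u\<bar> * norm (D u) + e * \<bar>v - u\<bar>"
      unfolding Pv using norm_triangle_ineq[of "(v - u) *\<^sub>R D u" R] R by simp
    then have "\<kappa> * dist (P u) z \<le> \<kappa> * (\<bar>v - u\<bar> * (norm (D u) + e))"
      using \<kappa> v(2) by (intro mult_left_mono) (auto simp: dist_norm norm_minus_commute algebra_simps)
    also have "\<dots> = \<bar>v - u\<bar> * (a / 2)"
    proof -
      have "norm (D u) + e > 0" using e by (simp add: add_nonneg_pos)
      then have "\<kappa> * (norm (D u) + e) = a / 2"
        by (metis \<kappa>_def less_numeral_extra(3) nonzero_eq_divide_eq)
      then show ?thesis by (metis mult.commute mult.left_commute)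
    qed
    also have "\<dots> \<le> \<bar>cross d (P v - P u)\<bar>"
    proof -
      have "\<bar>cross d R\<bar> \<le> norm d * (e * \<bar>v - u\<bar>)"
        using abs_cross_le[of d R] R by (meson mult_left_mono norm_ge_zero order_trans)
      also have "\<dots> \<le> a / 2 * \<bar>v - u\<bar>"
        using mult_right_mono[OF de, of "\<bar>v - u\<bar>"] by (simp add: algebra_simps)
      finally have "\<bar>cross d R\<bar> \<le> a / 2 * \<bar>v - u\<bar>" .
      moreover have "\<bar>(v - u) * cross d (D u)\<bar> = \<bar>v - u\<bar> * a" by (simp add: abs_mult a_def)
      moreover have "cross d (P v - P u) = (v - u) * cross d (D u) + cross d R"
        unfolding Pv by simp
      moreover have "a / 2 * \<bar>v - u\<bar> = (\<bar>v - u\<bar> * a) / 2" "\<bar>v - u\<bar> * (a / 2) = (\<bar>v - u\<bar> * a) / 2"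
        by simp_all
      ultimately show ?thesis by linarith
    qed
    finally show "\<kappa> * dist (P u) z \<le> \<bar>cross d (z - P u)\<bar>" using v by simp
  qed
qed

text \<open>Near \<open>P u\<close> the curve is a graph over the direction transversal to
  \<open>d\<close>. Translating a short arc along \<open>d\<close> in either sense sweeps out
  connected sets \<open>Up\<close> and \<open>Dn\<close> that miss the curve and, together with it,
  cover a neighbourhood of \<open>P u\<close>. Since \<open>P u\<close> is a frontier point of both
  the interior and the exterior, one of the two sets is interior and the other exterior.\<close>

lemma crossing_pos:
  assumes u: "u \<in> {0..1} - E" and c: "cross d (D u) > 0"
  shows "\<exists>\<epsilon>>0. \<forall>r. 0 < r \<longrightarrow> r < \<epsilon> \<longrightarrow> (P u + r *\<^sub>R d \<in> inside S) \<noteq> (P u - r *\<^sub>R d \<in> inside S)"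
proof -
  define h where "h = (\<lambda>v. cross d (P v - P u))"
  have d0: "norm d > 0" using c by auto
  have "isCont D u" using D2[OF u] has_vector_derivative_continuous by blast
  then have "((\<lambda>v. cross d (D v)) \<longlongrightarrow> cross d (D u)) (at u)"
    by (intro tendsto_cross) (auto simp: isCont_def)
  then have "eventually (\<lambda>v. cross d (D v) > 0) (nhds u)"
    using c by (metis order_tendstoD(1) eventually_nhds_conv_at)
  moreover have "eventually (\<lambda>v. v \<in> {0..1} - E) (nhds u)"
    using open_regular u eventually_nhds by blast
  ultimately have "eventually (\<lambda>v. cross d (D v) > 0 \<and> v \<in> {0..1} - E) (nhds u)"
    by (rule eventually_conj)
  then obtain \<delta>0 where \<delta>0: "\<delta>0 > 0" "\<And>v. \<bar>v - u\<bar> < \<delta>0 \<Longrightarrow> cross d (D v) > 0 \<and> v \<in> {0..1} - E"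
    unfolding eventually_nhds_metric dist_real_def by blast
  have h_mono: "h v < h w" if "\<bar>v - u\<bar> < \<delta>0" "\<bar>w - u\<bar> < \<delta>0" "v < w" for v w
  proof (rule DERIV_pos_imp_increasing[OF that(3)])
    fix x assume "v \<le> x" "x \<le> w"
    then have "\<bar>x - u\<bar> < \<delta>0" using that by linarith
    from \<delta>0(2)[OF this] show "\<exists>y. (h has_real_derivative y) (at x) \<and> 0 < y"
      unfolding h_def using has_real_derivative_cross_const[OF D] by blast
  qed
  obtain \<epsilon> where \<epsilon>: "\<epsilon> > 0" "\<And>v. v \<in> {0..1} \<Longrightarrow> dist (P u) (P v) < \<epsilon> \<Longrightarrow> \<bar>v - u\<bar> < \<delta>0"
    using near_parameter[OF u \<delta>0(1)] by metis
  have "isCont P u" using D[OF u] has_vector_derivative_continuous by blast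
  then have close: "\<exists>\<delta>>0. \<delta> < \<delta>0 \<and> (\<forall>v. \<bar>v - u\<bar> < \<delta> \<longrightarrow> dist (P u) (P v) < e)" if e: "e > 0" for e
  proof -
    obtain \<delta> where "\<delta> > 0" "\<And>v. \<bar>v - u\<bar> < \<delta> \<Longrightarrow> dist (P v) (P u) < e"
      using \<open>isCont P u\<close> e unfolding continuous_at_eps_delta by (metis dist_real_def)
    then show ?thesis using \<delta>0(1) by (intro exI[of _ "min \<delta> (\<delta>0 / 2)"]) (auto simp: dist_commute)
  qed
  obtain \<delta>1 where \<delta>1: "\<delta>1 > 0" "\<delta>1 < \<delta>0" "\<And>v. \<bar>v - u\<bar> < \<delta>1 \<Longrightarrow> dist (P u) (P v) < \<epsilon> / 2"
    using close[of "\<epsilon> / 2"] \<epsilon>(1) by auto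
  \<comment> \<open>Translates of the arc by less than this stay within \<open>\<epsilon>\<close> of
    \<open>P u\<close>, where \<open>near_parameter\<close> controls the parameter.\<close>
  define \<eta> where "\<eta> = \<epsilon> / (2 * norm d)"
  have \<eta>: "\<eta> > 0" "\<eta> * norm d = \<epsilon> / 2" using \<epsilon>(1) d0 by (auto simp: \<eta>_def)
  define F where "F = (\<lambda>(v, \<tau>). P v + \<tau> *\<^sub>R d)"
  define Up where "Up = F ` ({u - \<delta>1<..<u + \<delta>1} \<times> {0<..<\<eta>})"
  define Dn where "Dn = F ` ({u - \<delta>1<..<u + \<delta>1} \<times> {- \<eta><..<0})"
  have contF: "continuous_on ({u - \<delta>1<..<u + \<delta>1} \<times> T) F" for T
  proof -
    have "continuous_on {u - \<delta>1<..<u + \<delta>1} P"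
      by (rule continuous_on_subset[OF continuous_P]) (use \<delta>0(2) \<delta>1 in \<open>force simp: abs_less_iff\<close>)
    then have "continuous_on ({u - \<delta>1<..<u + \<delta>1} \<times> T) (\<lambda>x. P (fst x))"
      by (rule continuous_on_compose2) (auto intro: continuous_intros)
    then show ?thesis unfolding F_def case_prod_beta by (intro continuous_intros)
  qed
  have conn: "connected Up" "connected Dn"
    unfolding Up_def Dn_def by (intro connected_continuous_image contF connected_Times; simp)+
  have avoid: "P v + \<tau> *\<^sub>R d \<notin> S" if "\<bar>v - u\<bar> < \<delta>1" "\<bar>\<tau>\<bar> < \<eta>" "\<tau> \<noteq> 0" for v \<tau>
  proof
    assume "P v + \<tau> *\<^sub>R d \<in> S"
    then obtain w where w: "w \<in> {0..1}" "P w = P v + \<tau> *\<^sub>R d" by (auto simp: path_image_def)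
    have "dist (P u) (P w) \<le> dist (P u) (P v) + dist (P v) (P w)" by (rule dist_triangle)
    also have "dist (P v) (P w) = \<bar>\<tau>\<bar> * norm d" by (simp add: w(2) dist_norm)
    also have "\<bar>\<tau>\<bar> * norm d < \<eta> * norm d" using that(2) d0 by (intro mult_strict_right_mono)
    also note \<eta>(2)
    finally have "dist (P u) (P w) < \<epsilon>" using \<delta>1(3)[OF that(1)] by simp
    then have "\<bar>w - u\<bar> < \<delta>0" using \<epsilon>(2) w(1) by blast
    \<comment> \<open>Moving along \<open>d\<close> does not change \<open>h\<close>, and
      \<open>h\<close> is strictly monotone, so a hit would have to be \<open>P v\<close>
      itself.\<close>
    moreover have "h w = h v" by (simp add: h_def w(2))
    ultimately have "w = v" using h_mono[of w v] h_mono[of v w] that(1) \<delta>1(2) by fastforce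
    then show False using w(2) that(3) d0 by simp
  qed
  have disj: "Up \<inter> S = {}" "Dn \<inter> S = {}"
    using avoid by (auto simp: Up_def Dn_def F_def abs_less_iff)
  obtain \<delta>2 where \<delta>2: "\<delta>2 > 0" "\<delta>2 < \<delta>0" "\<And>v. \<bar>v - u\<bar> < \<delta>2 \<Longrightarrow> dist (P u) (P v) < \<eta> * norm d / 2"
    using close[of "\<eta> * norm d / 2"] \<eta>(1) d0 by auto
  define \<delta>3 where "\<delta>3 = min \<delta>1 \<delta>2 / 2"
  have \<delta>3: "\<delta>3 > 0" "\<delta>3 < \<delta>1" "\<delta>3 < \<delta>2" using \<delta>1 \<delta>2 by (auto simp: \<delta>3_def)
  have hs: "h (u - \<delta>3) < 0" "h (u + \<delta>3) > 0"
    using h_mono[of "u - \<delta>3" u] h_mono[of u "u + \<delta>3"] \<delta>3 \<delta>1 by (auto simp: h_def)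
  \<comment> \<open>The first two bounds place the level \<open>cross d (z - P u)\<close> between
    the end values of \<open>h\<close>, so that the intermediate value theorem gives a base point
    \<open>P v\<close>; the third keeps the offset of \<open>z\<close> from it below
    \<open>\<eta>\<close>.\<close>
  define \<rho> where "\<rho> = Min {h (u + \<delta>3) / norm d, - h (u - \<delta>3) / norm d, \<eta> * norm d / 2}"
  have \<rho>0: "\<rho> > 0" using hs d0 \<eta>(1) unfolding \<rho>_def by (subst Min_gr_iff) (auto simp: divide_neg_pos)
  have \<rho>: "\<rho> \<le> h (u + \<delta>3) / norm d" "\<rho> \<le> - h (u - \<delta>3) / norm d" "\<rho> \<le> \<eta> * norm d / 2"
    unfolding \<rho>_def by (rule Min_le; simp)+
  have cover: "z \<in> Up \<union> Dn \<union> S" if z: "dist (P u) z < \<rho>" for z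
  proof -
    define a where "a = cross d (z - P u)"
    have "\<bar>a\<bar> \<le> norm d * dist (P u) z"
      unfolding a_def dist_norm using abs_cross_le[of d "z - P u"] by (simp add: norm_minus_commute)
    then have a: "\<bar>a\<bar> < norm d * \<rho>" using z d0 by (smt (verit) mult_less_cancel_left_pos)
    have "norm d * \<rho> \<le> h (u + \<delta>3)" "norm d * \<rho> \<le> - h (u - \<delta>3)"
      using \<rho>(1,2) d0 by (simp_all add: field_simps)
    then have "h (u - \<delta>3) \<le> a" "a \<le> h (u + \<delta>3)" using a by linarith+
    moreover have "continuous_on {u - \<delta>3..u + \<delta>3} h"
    proof -
      have "{u - \<delta>3..u + \<delta>3} \<subseteq> {0..1}"
      proof
        fix x assume "x \<in> {u - \<delta>3..u + \<delta>3}"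
        then have "\<bar>x - u\<bar> < \<delta>0" using \<delta>3 \<delta>1 by (auto simp: abs_less_iff)
        then show "x \<in> {0..1}" using \<delta>0(2) by blast
      qed
      then show ?thesis unfolding h_def by (intro continuous_intros continuous_on_subset[OF continuous_P])
    qed
    ultimately obtain v where v: "u - \<delta>3 \<le> v" "v \<le> u + \<delta>3" "h v = a"
      using IVT'[of h "u - \<delta>3" a "u + \<delta>3"] \<delta>3(1) by auto
    have vu: "\<bar>v - u\<bar> < \<delta>1" "\<bar>v - u\<bar> < \<delta>2" using v \<delta>3 by (auto simp: abs_less_iff)
    have "cross d (z - P v) = 0" using v(3) by (simp add: h_def a_def)
    then obtain \<tau> where \<tau>: "z - P v = \<tau> *\<^sub>R d" using cross_eq_0_imp_parallel d0 by (metis norm_zero less_irrefl)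
    have "\<bar>\<tau>\<bar> * norm d = dist z (P v)" by (simp add: dist_norm \<tau>)
    also have "\<dots> \<le> dist z (P u) + dist (P u) (P v)" by (rule dist_triangle)
    also have "\<dots> < \<eta> * norm d / 2 + \<eta> * norm d / 2"
      using z \<rho>(3) \<delta>2(3)[OF vu(2)] by (intro add_strict_mono) (auto simp: dist_commute)
    finally have "\<bar>\<tau>\<bar> < \<eta>" using d0 by simp
    moreover have zF: "z = F (v, \<tau>)" using \<tau> by (simp add: F_def algebra_simps)
    moreover have "z \<in> S" if "\<tau> = 0"
    proof -
      have "z = P v" using \<tau> that by simp
      moreover have "v \<in> {0..1}" using \<delta>0(2)[of v] vu \<delta>1 by auto
      ultimately show ?thesis using P_in_S by blast
    qed
    moreover have "v \<in> {u - \<delta>1<..<u + \<delta>1}" using vu by (auto simp: abs_less_iff)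
    ultimately show ?thesis unfolding Up_def Dn_def
      by (cases "\<tau> = 0"; cases "\<tau> > 0") (auto simp: abs_less_iff)
  qed
  have fr: "frontier (inside S) = S" "frontier (outside S) = S" "inside S \<inter> outside S = {}"
    using Jordan_inside_outside[OF simple loop] by auto
  have uS: "P u \<in> S" using u P_in_S by blast
  obtain z1 where z1: "z1 \<in> inside S" "dist (P u) z1 < \<rho>"
    using frontier_straddle[of "P u" "inside S"] uS \<rho>0 fr(1) by blast
  obtain z2 where z2: "z2 \<in> outside S" "dist (P u) z2 < \<rho>"
    using frontier_straddle[of "P u" "outside S"] uS \<rho>0 fr(2) by blast
  have noS: "z1 \<notin> S" "z2 \<notin> S" "z2 \<notin> inside S"
    using z1 z2 fr(3) inside_no_overlap[of S] outside_no_overlap[of S] by blast+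
  show ?thesis
  proof (intro exI[of _ \<eta>] conjI allI impI)
    show "\<eta> > 0" by (rule \<eta>)
    fix r assume r: "0 < r" "r < \<eta>"
    have U: "P u + r *\<^sub>R d \<in> Up"
      unfolding Up_def by (rule image_eqI[of _ _ "(u, r)"]) (use r \<delta>1 in \<open>auto simp: F_def\<close>)
    have V: "P u - r *\<^sub>R d \<in> Dn"
      unfolding Dn_def by (rule image_eqI[of _ _ "(u, - r)"]) (use r \<delta>1 in \<open>auto simp: F_def\<close>)
    show "(P u + r *\<^sub>R d \<in> inside S) \<noteq> (P u - r *\<^sub>R d \<in> inside S)"
      using inside_const[OF conn(1) disj(1) U] inside_const[OF conn(2) disj(2) V]
        cover[OF z1(2)] cover[OF z2(2)] noS z1(1) by blast
  qed
qed

lemma crossing: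
  assumes u: "u \<in> {0..1} - E" and c: "cross d (D u) \<noteq> 0"
  shows "\<exists>\<epsilon>>0. \<forall>r. 0 < r \<longrightarrow> r < \<epsilon> \<longrightarrow> (P u + r *\<^sub>R d \<in> inside S) \<noteq> (P u - r *\<^sub>R d \<in> inside S)"
proof (cases "cross d (D u) > 0")
  case False
  then have "cross (- d) (D u) > 0" using c by simp
  from crossing_pos[OF u this] show ?thesis by auto
qed (rule crossing_pos[OF u])

end

subsection \<open>Generic sight lines\<close>

text \<open>Multiplication by \<open>d\<close> is a similarity and scales areas by the square of its
  factor. This allows computing in coordinates along and across \<open>d\<close>.\<close>

lemma cross_mult_mult: "cross (v * d) (w * d) = Im (cnj v * w) * (norm d)\<^sup>2"
  by (simp add: cross_eq cmod_power2, simp add: algebra_simps power2_eq_square)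

lemma cross_mult_self: "cross d (w * d) = Im w * (norm d)\<^sup>2"
  using cross_mult_mult[of 1 d w] by simp

context tame_loop
begin

text \<open>Parameters \<open>t\<close> whose line through \<open>P s\<close> also passes through a
  corner or a tangency seen from \<open>P s\<close>. The choice \<open>u = t\<close> is included, so
  for \<open>P t \<noteq> P s\<close> a generic \<open>t\<close> is regular and its tangent misses
  \<open>P s\<close>.\<close>

definition nongeneric :: "real \<Rightarrow> real set" where
  "nongeneric s = {t \<in> {0..1}. \<exists>u\<in>{0..1}. P u \<noteq> P s \<and> (u \<in> E \<or> cross (D u) (P u - P s) = 0) \<and>
     cross (P u - P s) (P t - P s) = 0}"

lemma countable_critical: "countable {u \<in> {0..1}. P u \<noteq> c \<and> (u \<in> E \<or> cross (D u) (P u - c) = 0)}"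
proof (rule countable_subset)
  show "countable (E \<union> {u \<in> {0..1} - E. P u \<noteq> c \<and> cross (D u) (P u - c) = 0})"
    using countable_tangents_from finite_E by (simp add: countable_finite)
qed auto

text \<open>Each of the countably many critical \<open>u\<close> fixes one line through
  \<open>P s\<close>, and that line contains finitely many curve parameters.\<close>

lemma countable_nongeneric: "countable (nongeneric s)"
proof -
  let ?V = "{u \<in> {0..1}. P u \<noteq> P s \<and> (u \<in> E \<or> cross (D u) (P u - P s) = 0)}"
  have "countable (\<Union>u\<in>?V. {t \<in> {0..1}. cross (P u - P s) (P t - P s) = 0})"
    by (rule countable_UN[OF countable_critical], rule countable_finite, rule finite_line) auto
  moreover have "nongeneric s \<subseteq> (\<Union>u\<in>?V. {t \<in> {0..1}. cross (P u - P s) (P t - P s) = 0})"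
    unfolding nongeneric_def by blast
  ultimately show ?thesis by (rule countable_subset[rotated])
qed

lemma finite_line_points:
  assumes "d \<noteq> 0"
  shows "finite {z \<in> S. cross d (z - c) = 0}"
proof -
  have "{z \<in> S. cross d (z - c) = 0} = P ` {u \<in> {0..1}. cross d (P u - c) = 0}"
    by (auto simp: path_image_def)
  then show ?thesis using finite_line[OF assms] by simp
qed

text \<open>\<open>card\<close> is also 0 on infinite sets; the finiteness of line intersections
  excludes this reading.\<close>

lemma visible_iff:
  assumes "x \<noteq> y"
  shows "Body P x y = 0 \<longleftrightarrow> open_segment x y \<inter> S = {}"
proof -
  have "S \<inter> open_segment x y \<subseteq> {z \<in> S. cross (y - x) (z - x) = 0}"
  proof
    fix z assume z: "z \<in> S \<inter> open_segment x y"
    then obtain r where "z = (1 - r) *\<^sub>R x + r *\<^sub>R y" by (auto simp: in_segment)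
    then have r: "z - x = r *\<^sub>R (y - x)" by (simp add: scaleR_left_diff_distrib scaleR_right_diff_distrib)
    have "cross (y - x) (z - x) = 0" unfolding r by (simp only: cross_simps mult_zero_right)
    then show "z \<in> {z \<in> S. cross (y - x) (z - x) = 0}" using z by blast
  qed
  then have "finite (S \<inter> open_segment x y)"
    by (rule finite_subset) (rule finite_line_points, use assms in simp)
  then show ?thesis unfolding Body_def by auto
qed

text \<open>On the ray from the midpoint through \<open>P t\<close>, the hits are \<open>P t\<close>
  and the points counted by Head. The extra hit \<open>P t\<close> turns the odd parity in
  \<open>parity_of_flips\<close> into an even one.\<close>

lemma generic_parity:
  assumes s: "s \<in> {0..1}" and t: "t \<in> {0..1}" "t \<notin> nongeneric s" and ne: "P s \<noteq> P t"
    and vis: "open_segment (P s) (P t) \<inter> S = {}"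
  shows "midpoint (P s) (P t) \<in> inside S \<longleftrightarrow> even (Head P (P s) (P t))"
proof -
  define x where "x = P s"
  define d where "d = P t - P s"
  have d0: "d \<noteq> 0" using ne by (simp add: d_def)
  define g where "g = (\<lambda>r. x + r *\<^sub>R d)"
  have g_inj: "inj g" using d0 by (auto simp: inj_def g_def)
  have g_cross: "cross d (g r - x) = 0" for r by (simp add: g_def)
  have g1: "g 1 = P t" by (simp add: g_def d_def x_def)
  have body: "g r \<notin> S" if "0 < r" "r < 1" for r
  proof -
    have "g r = (1 - r) *\<^sub>R P s + r *\<^sub>R P t" by (simp add: g_def d_def x_def algebra_simps)
    then have "g r \<in> open_segment (P s) (P t)" using that ne by (auto simp: in_segment)
    then show ?thesis using vis by blast
  qed
  define A where "A = {r. 1/2 < r \<and> g r \<in> S}"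
  have "finite (g ` A)"
    by (rule finite_subset[OF _ finite_line_points[OF d0, of x]]) (use g_cross in \<open>auto simp: A_def simp del: cross_simps\<close>)
  then have finA: "finite A" using g_inj by (meson finite_imageD inj_on_subset subset_UNIV)
  have mid: "g (1/2) = midpoint (P s) (P t)"
    by (simp add: g_def d_def x_def midpoint_def complex_eq_iff field_simps)
  obtain M where M: "\<And>z. z \<in> inside S \<Longrightarrow> norm z \<le> M"
    using Jordan_inside_outside[OF simple loop] bounded_iff by metis
  have "g (1/2) \<in> inside S \<longleftrightarrow> odd (card {a \<in> A. 1/2 < a})"
  proof (rule parity_of_flips[OF finA, where r0 = "1/2" and M = "(M + norm x) / norm d"])
    fix p q :: real assume pq: "1/2 \<le> p" "p < q" "{p..q} \<inter> A = {}"
    have "connected (g ` {p..q})"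
      unfolding g_def by (intro connected_continuous_image continuous_intros) simp
    moreover have "g ` {p..q} \<inter> S = {}"
    proof -
      have "g r \<notin> S" if "r \<in> {p..q}" for r
      proof
        assume "g r \<in> S"
        then have "1/2 < r \<longrightarrow> r \<in> A" by (simp add: A_def)
        moreover have "r \<notin> A" using that pq(3) by blast
        moreover have "1/2 \<le> r" using that pq(1) by simp
        ultimately show False using body[of r] \<open>g r \<in> S\<close> by simp
      qed
      then show ?thesis by blast
    qed
    ultimately show "(g p \<in> inside S) = (g q \<in> inside S)"
      by (rule inside_const) (use pq in auto)
  next
    fix a assume a: "a \<in> A"
    then obtain u where u: "u \<in> {0..1}" "P u = x + a *\<^sub>R d" "0 < a" by (auto simp: A_def g_def path_image_def)
    have "P u \<noteq> P s" using u d0 by (simp add: x_def)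
    moreover have "cross (P u - P s) (P t - P s) = 0" unfolding u(2) x_def[symmetric]
      by (simp add: d_def x_def cross_eq algebra_simps)
    ultimately have reg: "u \<notin> E" "cross (D u) (P u - P s) \<noteq> 0"
      using t u(1) unfolding nongeneric_def by blast+
    have "cross (D u) (P u - P s) = a * cross (D u) d" using u by (simp add: x_def)
    then have "cross d (D u) \<noteq> 0" using reg(2) by (auto simp: cross_eq mult.commute)
    then obtain e where "e > 0" "\<And>r. 0 < r \<Longrightarrow> r < e \<Longrightarrow> (P u + r *\<^sub>R d \<in> inside S) \<noteq> (P u - r *\<^sub>R d \<in> inside S)"
      using crossing[of u d] u(1) reg(1) by auto
    moreover have "g (a + r) = P u + r *\<^sub>R d" "g (a - r) = P u - r *\<^sub>R d" for r
      by (simp_all add: g_def u algebra_simps)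
    ultimately show "\<exists>e>0. \<forall>r. 0 < r \<longrightarrow> r < e \<longrightarrow> (g (a + r) \<in> inside S) \<noteq> (g (a - r) \<in> inside S)"
      by metis
  next
    fix r :: real assume r: "(M + norm x) / norm d < r"
    then have "M + norm x < r * norm d" using d0 by (simp add: field_simps)
    also have "\<dots> \<le> norm (r *\<^sub>R d)" by (simp add: mult_right_mono)
    also have "\<dots> \<le> norm (g r) + norm x"
      using norm_triangle_ineq4[of "g r" x] by (simp add: g_def)
    finally show "g r \<notin> inside S" using M[of "g r"] by auto
  qed (auto simp: A_def)
  \<comment> \<open>\<open>P t\<close> sits at position 1, and visibility excludes hits between 1/2
    and 1.\<close>
  also have "{a \<in> A. 1/2 < a} = insert 1 {r. 1 < r \<and> g r \<in> S}"
  proof -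
    have "r = 1 \<or> 1 < r" if "1/2 < r" "g r \<in> S" for r using body[of r] that by force
    then show ?thesis using g1 t P_in_S by (auto simp: A_def)
  qed
  also have "card (insert 1 {r. 1 < r \<and> g r \<in> S}) = Suc (card {r. 1 < r \<and> g r \<in> S})"
    by (rule card_insert_disjoint) (auto intro: finite_subset[OF _ finA] simp: A_def)
  also have "card {r. 1 < r \<and> g r \<in> S} = card (g ` {r. 1 < r \<and> g r \<in> S})"
    by (rule card_image[OF inj_on_subset[OF g_inj subset_UNIV], symmetric])
  also have "g ` {r. 1 < r \<and> g r \<in> S} = S \<inter> open_ray_beyond (P s) (P t)"
  proof -
    have ray: "g (1 + r) = P t + r *\<^sub>R (P t - P s)" for r by (simp add: g_def d_def x_def algebra_simps)
    have "open_ray_beyond (P s) (P t) = g ` {1<..}"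
    proof (intro set_eqI iffI)
      fix z assume "z \<in> open_ray_beyond (P s) (P t)"
      then obtain r where "0 < r" "z = g (1 + r)" unfolding open_ray_beyond_def ray by blast
      then show "z \<in> g ` {1<..}" by auto
    next
      fix z assume "z \<in> g ` {1<..}"
      then obtain r where "1 < r" "z = g (1 + (r - 1))" by auto
      then show "z \<in> open_ray_beyond (P s) (P t)" unfolding open_ray_beyond_def ray
        by (metis (mono_tags, lifting) CollectI diff_gt_0_iff_gt)
    qed
    then show ?thesis by auto
  qed
  finally show ?thesis by (simp add: mid Head_def)
qed

end

subsection \<open>Perturbing a sight line\<close>

context curved_loop
begin

text \<open>Outside a ball about \<open>x\<close>, the compact curve is disjoint from the segment
  and so at positive distance from it.\<close>

lemma near_segment:
  assumes "closed_segment m x \<inter> S \<subseteq> {x}" "\<epsilon> > 0"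
  obtains \<rho> where "\<rho> > 0" "\<And>z q. z \<in> S \<Longrightarrow> q \<in> closed_segment m x \<Longrightarrow> dist z q < \<rho> \<Longrightarrow> dist z x < \<epsilon>"
proof -
  have "compact (S - ball x \<epsilon>)" by (intro compact_diff compact_S) auto
  moreover have "(S - ball x \<epsilon>) \<inter> closed_segment m x = {}" using assms by auto
  ultimately obtain \<rho> where "\<rho> > 0" "\<forall>z\<in>S - ball x \<epsilon>. \<forall>q\<in>closed_segment m x. \<rho> \<le> dist z q"
    using separate_compact_closed[of "S - ball x \<epsilon>" "closed_segment m x"] closed_segment by blast
  then show ?thesis by (intro that[of \<rho>]) (force simp: dist_commute)+
qed

lemma first_hit:
  assumes "k \<in> S"
  obtains p where "p \<in> S" "p \<in> closed_segment c k" "open_segment c p \<inter> S = {}"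
proof -
  have "compact (S \<inter> closed_segment c k)" "S \<inter> closed_segment c k \<noteq> {}"
    using compact_S assms by (auto intro: compact_Int)
  then obtain p where p: "p \<in> S \<inter> closed_segment c k" "\<And>z. z \<in> S \<inter> closed_segment c k \<Longrightarrow> dist c p \<le> dist c z"
    using distance_attains_inf[of "S \<inter> closed_segment c k" c] compact_imp_closed by metis
  have "z \<notin> S" if "z \<in> open_segment c p" for z
  proof
    assume "z \<in> S"
    have "z \<in> closed_segment c k"
      using that p(1) by (metis IntD2 ends_in_segment(1) open_closed_segment subset_closed_segment subsetD)
    then have "dist c p \<le> dist c z" using p(2) \<open>z \<in> S\<close> by blast
    then show False using dist_in_open_segment[OF that] by (simp add: dist_commute)
  qed
  then show ?thesis using p(1) by (intro that[of p]) auto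
qed

text \<open>The first hit on the way to \<open>k\<close> may differ from \<open>k\<close>, but it is
  close to the segment from \<open>m\<close> to \<open>x\<close>, and the curve approaches that
  segment only near \<open>x\<close>.\<close>

lemma hit_near_endpoint:
  assumes "closed_segment m x \<inter> S \<subseteq> {x}" "\<epsilon> > 0"
  obtains \<rho> where "\<rho> > 0" "\<And>c k. dist c m < \<rho> \<Longrightarrow> k \<in> S \<Longrightarrow> dist k x < \<rho> \<Longrightarrow>
    \<exists>p\<in>S. p \<in> closed_segment c k \<and> open_segment c p \<inter> S = {} \<and> dist p x < \<epsilon>"
proof -
  obtain \<rho> where \<rho>: "\<rho> > 0" "\<And>z q. z \<in> S \<Longrightarrow> q \<in> closed_segment m x \<Longrightarrow> dist z q < \<rho> \<Longrightarrow> dist z x < \<epsilon>"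
    using near_segment[OF assms] by metis
  show ?thesis
  proof (rule that[OF \<rho>(1)])
    fix c k assume c: "dist c m < \<rho>" and k: "k \<in> S" "dist k x < \<rho>"
    obtain p where p: "p \<in> S" "p \<in> closed_segment c k" "open_segment c p \<inter> S = {}"
      using first_hit[OF k(1)] by metis
    obtain \<tau> where \<tau>: "0 \<le> \<tau>" "\<tau> \<le> 1" "p = (1 - \<tau>) *\<^sub>R c + \<tau> *\<^sub>R k" using p(2) by (auto simp: in_segment)
    define q where "q = (1 - \<tau>) *\<^sub>R m + \<tau> *\<^sub>R x"
    have "p - q = (1 - \<tau>) *\<^sub>R (c - m) + \<tau> *\<^sub>R (k - x)" by (simp add: \<tau> q_def algebra_simps)
    then have "dist p q \<le> (1 - \<tau>) * dist c m + \<tau> * dist k x"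
      using norm_triangle_ineq[of "(1 - \<tau>) *\<^sub>R (c - m)" "\<tau> *\<^sub>R (k - x)"] \<tau> by (simp add: dist_norm)
    also have "\<dots> < \<rho>" by (rule convex_bound_lt) (use c k \<tau> in auto)
    finally have "dist p x < \<epsilon>" using \<rho>(2)[OF p(1)] \<tau> by (auto simp: q_def in_segment)
    then show "\<exists>p\<in>S. p \<in> closed_segment c k \<and> open_segment c p \<inter> S = {} \<and> dist p x < \<epsilon>"
      using p by blast
  qed
qed

lemma arc_meets_line:
  assumes seg: "closed_segment u v \<subseteq> {0..1}" and opp: "cross e (P u - c) * cross e (P v - c) < 0"
  obtains w where "w \<in> closed_segment u v" "cross e (P w - c) = 0"
proof -
  let ?T = "(\<lambda>w. cross e (P w - c)) ` closed_segment u v"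
  have "connected ?T"
    by (intro connected_continuous_image continuous_intros continuous_on_subset[OF continuous_P seg]) simp
  moreover have "cross e (P u - c) \<in> ?T" "cross e (P v - c) \<in> ?T" by (simp_all del: cross_simps)
  ultimately have "0 \<in> ?T"
    using opp unfolding connected_iff_interval mult_less_0_iff by (metis less_imp_le)
  then show ?thesis using that by (auto simp del: cross_simps)
qed

end

context tame_loop
begin

text \<open>Supplies a short arc whose two ends a slightly moved line can separate, so that the
  moved line must still meet the curve near \<open>P u0\<close>.\<close>

lemma arc_off_line:
  assumes u0: "u0 \<in> {0..1}" and "d \<noteq> 0" "\<rho> > 0"
  obtains u where "closed_segment u0 u \<subseteq> {0..1}" "cross d (P u - P u0) \<noteq> 0"
    "\<And>v. v \<in> closed_segment u0 u \<Longrightarrow> dist (P v) (P u0) < \<rho>"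
proof -
  obtain \<delta> where \<delta>: "\<delta> > 0" "\<And>v. v \<in> {0..1} \<Longrightarrow> dist v u0 < \<delta> \<Longrightarrow> dist (P v) (P u0) < \<rho>"
    using continuous_P u0 \<open>\<rho> > 0\<close> unfolding continuous_on_iff by metis
  obtain a b where ab: "a < b" "{a..b} \<subseteq> {0..1} \<inter> ball u0 \<delta>"
  proof (cases "u0 < 1")
    case True
    show ?thesis
      by (rule that[of u0 "min 1 (u0 + \<delta> / 2)"]) (use True u0 \<delta>(1) in \<open>auto simp: dist_real_def\<close>)
  next
    case False
    show ?thesis
      by (rule that[of "max 0 (u0 - \<delta> / 2)" u0]) (use False u0 \<delta>(1) in \<open>auto simp: dist_real_def\<close>)
  qed
  have "infinite {a..b}" using ab by simp
  then have "{a..b} - {u \<in> {0..1}. cross d (P u - P u0) = 0} \<noteq> {}"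
    using finite_line[OF \<open>d \<noteq> 0\<close>] by (metis Diff_infinite_finite finite.emptyI)
  then obtain u where u: "u \<in> {0..1}" "dist u0 u < \<delta>" "cross d (P u - P u0) \<noteq> 0"
    using ab(2) by (force simp del: cross_simps)
  have seg: "closed_segment u0 u \<subseteq> {0..1}" by (rule closed_segment_subset) (use u u0 in auto)
  show ?thesis
  proof (rule that[OF seg u(3)])
    fix v assume v: "v \<in> closed_segment u0 u"
    then have "dist v u0 \<le> dist u0 u" using dist_in_closed_segment[OF v] by (simp add: dist_commute)
    then show "dist (P v) (P u0) < \<rho>" using \<delta>(2) seg v u(2) by auto
  qed
qed

end

context tame_loop
begin

text \<open>A curve point other than \<open>c\<close> lies on lines through \<open>c\<close> of at
  most one slope relative to \<open>e\<close>, and there are countably many critical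
  parameters.\<close>

lemma countable_critical_slopes:
  assumes "c \<notin> S" "e \<noteq> 0"
  shows "countable {\<theta>. \<exists>u\<in>{0..1}. (u \<in> E \<or> cross (D u) (P u - c) = 0) \<and> cross (Complex 1 \<theta> * e) (P u - c) = 0}"
    (is "countable ?\<Theta>")
proof -
  let ?V = "{u \<in> {0..1}. P u \<noteq> c \<and> (u \<in> E \<or> cross (D u) (P u - c) = 0)}"
  define w where "w = (\<lambda>u. cnj e * (P u - c))"
  have "?\<Theta> \<subseteq> (\<lambda>u. Im (w u) / Re (w u)) ` ?V"
  proof
    fix \<theta> assume "\<theta> \<in> ?\<Theta>"
    then obtain u where u: "u \<in> {0..1}" "u \<in> E \<or> cross (D u) (P u - c) = 0" "cross (Complex 1 \<theta> * e) (P u - c) = 0"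
      by blast
    have "P u \<noteq> c" using assms u(1) P_in_S by blast
    then have "w u \<noteq> 0" using assms(2) by (simp add: w_def)
    have "cross (Complex 1 \<theta> * e) (P u - c) = Im (cnj (Complex 1 \<theta>) * w u)"
      unfolding cross_def w_def by (simp only: complex_cnj_mult mult.assoc)
    then have "Im (w u) = \<theta> * Re (w u)" using u(3) by (simp only: times_complex.sel complex_cnj) simp
    then have "\<theta> = Im (w u) / Re (w u)" using \<open>w u \<noteq> 0\<close> by (cases "Re (w u) = 0") (simp_all add: complex_eq_iff)
    then show "\<theta> \<in> (\<lambda>u. Im (w u) / Re (w u)) ` ?V" using u \<open>P u \<noteq> c\<close> by blast
  qed
  then show ?thesis by (rule countable_subset) (intro countable_image countable_critical)
qed

text \<open>Perturb the sight line \<open>x y\<close> to a line meeting small arcs of the curve at \<open>x\<close> and at \<open>y\<close>,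
  turn it about a point \<open>c\<close> near the midpoint until it crosses the curve transversally at its first
  hit \<open>P s'\<close> near \<open>x\<close>, and then turn it about \<open>P s'\<close>; transversality keeps \<open>P s'\<close> visible.\<close>

lemma uncountably_many_visible_nearby:
  assumes s: "s \<in> {0..1}" and t: "t \<in> {0..1}" and ne: "P s \<noteq> P t"
    and vis: "open_segment (P s) (P t) \<inter> S = {}" and "\<epsilon> > 0"
  obtains s' where "s' \<in> {0..1}" "dist (P s') (P s) < \<epsilon>"
    "uncountable {t' \<in> {0..1}. dist (P t') (P t) < \<epsilon> \<and> P s' \<noteq> P t' \<and> open_segment (P s') (P t') \<inter> S = {}}"
proof -
  define x y d m where "x = P s" and "y = P t" and "d = P t - P s" and "m = P s + (1/2) *\<^sub>R (P t - P s)"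
  have d0: "d \<noteq> 0" "norm d > 0" using ne by (auto simp: d_def)
  have xm: "x = m - (1/2) *\<^sub>R d" and ym: "y = m + (1/2) *\<^sub>R d"
    by (simp_all add: x_def y_def m_def d_def complex_eq_iff field_simps)
  have m_in: "m \<in> open_segment x y"
    unfolding in_segment using ne by (intro conjI exI[of _ "1/2"]) (auto simp: x_def y_def m_def complex_eq_iff field_simps)
  have segs: "closed_segment m x \<inter> S \<subseteq> {x}" "closed_segment m y \<inter> S \<subseteq> {y}"
  proof -
    have "closed_segment m x \<subseteq> insert x (open_segment x y)" "closed_segment m y \<subseteq> insert y (open_segment x y)"
      using m_in subset_open_segment[of m x x y] subset_open_segment[of m y x y] open_closed_segment[OF m_in]
      by (auto simp: closed_segment_eq_open)
    with vis show "closed_segment m x \<inter> S \<subseteq> {x}" "closed_segment m y \<inter> S \<subseteq> {y}"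
      by (auto simp: x_def y_def)
  qed
  have mS: "m \<notin> S" using m_in vis by (auto simp: x_def y_def)
  define \<epsilon>' where "\<epsilon>' = min \<epsilon> (norm d / 4)"
  have \<epsilon>': "\<epsilon>' > 0" using \<open>\<epsilon> > 0\<close> d0 by (simp add: \<epsilon>'_def)
  obtain \<rho>1 where \<rho>1: "\<rho>1 > 0" "\<And>c k. dist c m < \<rho>1 \<Longrightarrow> k \<in> S \<Longrightarrow> dist k x < \<rho>1 \<Longrightarrow>
    \<exists>p\<in>S. p \<in> closed_segment c k \<and> open_segment c p \<inter> S = {} \<and> dist p x < \<epsilon>'"
    using hit_near_endpoint[OF segs(1) \<epsilon>'] by metis
  obtain \<rho>2 where \<rho>2: "\<rho>2 > 0" "\<And>c k. dist c m < \<rho>2 \<Longrightarrow> k \<in> S \<Longrightarrow> dist k y < \<rho>2 \<Longrightarrow>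
    \<exists>p\<in>S. p \<in> closed_segment c k \<and> open_segment c p \<inter> S = {} \<and> dist p y < \<epsilon>'"
    using hit_near_endpoint[OF segs(2) \<epsilon>'] by metis
  \<comment> \<open>The bound \<open>norm d / 8\<close> gives
    \<open>2 * \<rho> < norm d / 2\<close>, which decides in \<open>sgn\<close> on which side of
    \<open>c\<close> each arc is hit.\<close>
  define \<rho> where "\<rho> = min (min \<rho>1 \<rho>2) (norm d / 8)"
  have \<rho>: "\<rho> > 0" "\<rho> \<le> \<rho>1" "\<rho> \<le> \<rho>2" "\<rho> \<le> norm d / 8" using \<rho>1(1) \<rho>2(1) d0 by (auto simp: \<rho>_def)
  obtain u where u: "closed_segment s u \<subseteq> {0..1}" "cross d (P u - x) \<noteq> 0"
    "\<And>v. v \<in> closed_segment s u \<Longrightarrow> dist (P v) x < \<rho>"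
    using arc_off_line[OF s d0(1) \<rho>(1)] unfolding x_def by metis
  obtain v where v: "closed_segment t v \<subseteq> {0..1}" "cross d (P v - y) \<noteq> 0"
    "\<And>w. w \<in> closed_segment t v \<Longrightarrow> dist (P w) y < \<rho>"
    using arc_off_line[OF t d0(1) \<rho>(1)] unfolding y_def by metis
  \<comment> \<open>The line through \<open>c\<close> with direction \<open>e\<close> strictly
    separates the ends of both short arcs. All conditions are open, so they survive small turns;
    \<open>dist e d < norm d\<close> also forces \<open>e \<noteq> 0\<close>.\<close>
  define good where "good = (\<lambda>c e. cross e (x - c) * cross e (P u - c) < 0 \<and>
    cross e (y - c) * cross e (P v - c) < 0 \<and> dist c m < \<rho> \<and> dist e d < norm d \<and> c \<notin> S)"
  have good_open: "eventually (\<lambda>r. good (c r) (e r)) F"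
    if g: "good c0 e0" and lim: "(c \<longlongrightarrow> c0) F" "(e \<longlongrightarrow> e0) F" for c e :: "real \<Rightarrow> complex" and c0 e0 F
  proof -
    have "((\<lambda>r. cross (e r) (x - c r) * cross (e r) (P u - c r)) \<longlongrightarrow> cross e0 (x - c0) * cross e0 (P u - c0)) F"
      "((\<lambda>r. cross (e r) (y - c r) * cross (e r) (P v - c r)) \<longlongrightarrow> cross e0 (y - c0) * cross e0 (P v - c0)) F"
      "((\<lambda>r. dist (c r) m) \<longlongrightarrow> dist c0 m) F" "((\<lambda>r. dist (e r) d) \<longlongrightarrow> dist e0 d) F"
      by (intro tendsto_intros lim)+
    moreover have "eventually (\<lambda>r. c r \<in> - S) F"
      using topological_tendstoD[OF lim(1) open_Compl[OF closed_S]] g by (simp add: good_def)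
    ultimately show ?thesis
      using g unfolding good_def by (auto intro!: eventually_conj dest: order_tendstoD simp del: cross_simps)
  qed
  have hits: "(\<exists>a k. a > 0 \<and> k = c - a *\<^sub>R e \<and> k \<in> S \<and> dist k x < \<rho>) \<and> (\<exists>b k. b > 0 \<and> k = c + b *\<^sub>R e \<and> k \<in> S \<and> dist k y < \<rho>)"
    if g: "good c e" for c e
  proof -
    have e: "norm (e - d) < norm d" "e \<noteq> 0" and c: "norm (c - m) < \<rho>" using g by (auto simp: good_def dist_norm)
    \<comment> \<open>\<open>\<sigma>\<close> is 1 at the end \<open>y\<close> and -1 at the end
      \<open>x\<close>. For \<open>r \<le> 0\<close>, the vector \<open>(1/2) d - r e\<close> has
      norm at least \<open>norm d / 2\<close>, because \<open>e\<close> differs from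
      \<open>d\<close> by less than \<open>norm d\<close>; this is too far for a point within
      \<open>\<rho>\<close> of the end.\<close>
    have sgn: "r > 0" if k: "dist (m + (\<sigma> / 2) *\<^sub>R d) (c + (\<sigma> * r) *\<^sub>R e) < \<rho>" and \<sigma>: "\<sigma> = 1 \<or> \<sigma> = - 1" for \<sigma> r
    proof (rule ccontr)
      assume "\<not> r > 0"
      have "norm ((1/2 - r) *\<^sub>R d) \<le> norm ((1/2 - r) *\<^sub>R d + (- r) *\<^sub>R (e - d)) + norm (r *\<^sub>R (e - d))"
        using norm_triangle_ineq4[of "(1/2 - r) *\<^sub>R d + (- r) *\<^sub>R (e - d)" "(- r) *\<^sub>R (e - d)"] by simp
      moreover have "norm (r *\<^sub>R (e - d)) \<le> (- r) * norm d"
      proof -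
        have "norm (r *\<^sub>R (e - d)) = (- r) * norm (e - d)" using \<open>\<not> r > 0\<close> by simp
        also have "\<dots> \<le> (- r) * norm d" using \<open>\<not> r > 0\<close> e by (intro mult_left_mono) auto
        finally show ?thesis .
      qed
      moreover have "norm ((1/2 - r) *\<^sub>R d) = (1/2 - r) * norm d" using \<open>\<not> r > 0\<close> by simp
      moreover have "norm ((1/2 - r) *\<^sub>R d + (- r) *\<^sub>R (e - d)) < 2 * \<rho>"
      proof -
        have "m + (\<sigma> / 2) *\<^sub>R d - (c + (\<sigma> * r) *\<^sub>R e) = \<sigma> *\<^sub>R ((1/2 - r) *\<^sub>R d + (- r) *\<^sub>R (e - d)) - (c - m)"
          by (simp add: algebra_simps)
        then have "norm (\<sigma> *\<^sub>R ((1/2 - r) *\<^sub>R d + (- r) *\<^sub>R (e - d))) \<le> dist (m + (\<sigma> / 2) *\<^sub>R d) (c + (\<sigma> * r) *\<^sub>R e) + norm (c - m)"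
          unfolding dist_norm by (metis diff_add_cancel norm_triangle_ineq)
        moreover have "norm (\<sigma> *\<^sub>R ((1/2 - r) *\<^sub>R d + (- r) *\<^sub>R (e - d))) = norm ((1/2 - r) *\<^sub>R d + (- r) *\<^sub>R (e - d))"
          using \<sigma> by (subst norm_scaleR) auto
        ultimately show ?thesis using k c by linarith
      qed
      ultimately have "(1/2 - r) * norm d < 2 * \<rho> + (- r) * norm d" by linarith
      then show False using \<rho>(4) d0(2) by (simp add: algebra_simps)
    qed
    obtain p where p: "p \<in> closed_segment s u" "cross e (P p - c) = 0"
      using arc_meets_line[OF u(1), of e c] g unfolding good_def x_def by metis
    obtain q where q: "q \<in> closed_segment t v" "cross e (P q - c) = 0"
      using arc_meets_line[OF v(1), of e c] g unfolding good_def y_def by metis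
    obtain a where a: "P p - c = a *\<^sub>R e" using cross_eq_0_imp_parallel[OF p(2) e(2)] .
    obtain b where b: "P q - c = b *\<^sub>R e" using cross_eq_0_imp_parallel[OF q(2) e(2)] .
    have Pa: "P p = c - (- a) *\<^sub>R e" and Pb: "P q = c + b *\<^sub>R e" using a b by (simp_all add: algebra_simps)
    have "- a > 0" using sgn[of "- 1" "- a"] u(3)[OF p(1)] Pa by (simp add: xm dist_commute)
    moreover have "b > 0" using sgn[of 1 b] v(3)[OF q(1)] Pb by (simp add: ym dist_commute)
    moreover have "P p \<in> S" "P q \<in> S" using p(1) q(1) u(1) v(1) P_in_S by blast+
    ultimately show ?thesis using Pa Pb u(3)[OF p(1)] v(3)[OF q(1)] by metis
  qed
  obtain c e0 where ce0: "good c e0"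
  proof -
    define \<alpha> \<beta> where "\<alpha> = cross d (P u - x)" and "\<beta> = cross d (P v - y)"
    \<comment> \<open>In coordinates along and across \<open>d\<close>, centred at \<open>m\<close>,
      this line has height \<open>\<mu> * \<alpha>\<close> at \<open>x\<close> and
      \<open>\<mu> * \<beta>\<close> at \<open>y\<close>. For small positive \<open>\<mu>\<close> it
      thus passes between \<open>x\<close> and \<open>P u\<close> and between \<open>y\<close> and
      \<open>P v\<close>.\<close>
    define c where "c = (\<lambda>\<mu>. m + Complex 0 (\<mu> * (\<alpha> + \<beta>) / 2) * d)"
    define e where "e = (\<lambda>\<mu>. Complex 1 (\<mu> * (\<beta> - \<alpha>)) * d)"
    have c0: "(c \<longlongrightarrow> m) (at_right 0)" and e0: "(e \<longlongrightarrow> d) (at_right 0)"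
    proof -
      have "((\<lambda>\<mu>. m + Complex 0 (\<mu> * (\<alpha> + \<beta>) / 2) * d) \<longlongrightarrow> m + Complex 0 (0 * (\<alpha> + \<beta>) / 2) * d) (at_right 0)"
        "((\<lambda>\<mu>. Complex 1 (\<mu> * (\<beta> - \<alpha>)) * d) \<longlongrightarrow> Complex 1 (0 * (\<beta> - \<alpha>)) * d) (at_right 0)"
        by (intro tendsto_intros; simp)+
      moreover have "Complex 0 0 = 0" "Complex 1 0 = 1" by (simp_all add: complex_eq_iff)
      ultimately show "(c \<longlongrightarrow> m) (at_right 0)" "(e \<longlongrightarrow> d) (at_right 0)" by (simp_all add: c_def e_def)
    qed
    have ex: "cross (e \<mu>) (x - c \<mu>) = - (\<mu> * \<alpha> * (norm d)\<^sup>2)" for \<mu>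
    proof -
      have "x - c \<mu> = Complex (- 1/2) (- (\<mu> * (\<alpha> + \<beta>) / 2)) * d"
        unfolding xm c_def by (simp add: complex_eq_iff algebra_simps)
      then show ?thesis unfolding e_def by (simp only: cross_mult_mult) (simp add: algebra_simps add_divide_distrib diff_divide_distrib)
    qed
    have ey: "cross (e \<mu>) (y - c \<mu>) = - (\<mu> * \<beta> * (norm d)\<^sup>2)" for \<mu>
    proof -
      have "y - c \<mu> = Complex (1/2) (- (\<mu> * (\<alpha> + \<beta>) / 2)) * d"
        unfolding ym c_def by (simp add: complex_eq_iff algebra_simps)
      then show ?thesis unfolding e_def by (simp only: cross_mult_mult) (simp add: algebra_simps add_divide_distrib diff_divide_distrib)
    qed
    have "cross d (P u - m) = \<alpha>" "cross d (P v - m) = \<beta>"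
      unfolding \<alpha>_def \<beta>_def xm ym by simp_all
    then have "((\<lambda>\<mu>. \<alpha> * cross (e \<mu>) (P u - c \<mu>)) \<longlongrightarrow> \<alpha> * \<alpha>) (at_right 0)"
      "((\<lambda>\<mu>. \<beta> * cross (e \<mu>) (P v - c \<mu>)) \<longlongrightarrow> \<beta> * \<beta>) (at_right 0)"
      using tendsto_mult[OF tendsto_const tendsto_cross[OF e0 tendsto_diff[OF tendsto_const c0]], of \<alpha> "P u"]
        tendsto_mult[OF tendsto_const tendsto_cross[OF e0 tendsto_diff[OF tendsto_const c0]], of \<beta> "P v"]
      by (simp_all only:)
    moreover have "\<alpha> * \<alpha> > 0" "\<beta> * \<beta> > 0" using u(2) v(2) by (auto simp: \<alpha>_def \<beta>_def zero_less_mult_iff simp del: cross_simps)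
    ultimately have 1: "eventually (\<lambda>\<mu>. \<alpha> * cross (e \<mu>) (P u - c \<mu>) > 0) (at_right 0)"
      "eventually (\<lambda>\<mu>. \<beta> * cross (e \<mu>) (P v - c \<mu>) > 0) (at_right 0)"
      by (auto dest: order_tendstoD simp del: cross_simps)
    have 2: "eventually (\<lambda>\<mu>. dist (c \<mu>) m < \<rho>) (at_right 0)" "eventually (\<lambda>\<mu>. dist (e \<mu>) d < norm d) (at_right 0)"
      using tendstoD[OF c0 \<rho>(1)] tendstoD[OF e0 d0(2)] .
    have 3: "eventually (\<lambda>\<mu>. c \<mu> \<in> - S) (at_right 0)"
      using topological_tendstoD[OF c0 open_Compl[OF closed_S]] mS by simp
    have 4: "eventually (\<lambda>\<mu>::real. 0 < \<mu>) (at_right 0)" by (rule eventually_at_right_less)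
    have "eventually (\<lambda>\<mu>. good (c \<mu>) (e \<mu>)) (at_right 0)"
      using 1 2 3 4
    proof eventually_elim
      case (elim \<mu>)
      have neg: "- (\<mu> * \<alpha> * (norm d)\<^sup>2) * X < 0" if "\<alpha> * X > 0" for \<alpha> X
      proof -
        have "0 < (\<mu> * (norm d)\<^sup>2) * (\<alpha> * X)" by (rule mult_pos_pos[OF _ that]) (use \<open>0 < \<mu>\<close> d0 in simp)
        then show ?thesis by (simp add: algebra_simps)
      qed
      show ?case unfolding good_def ex ey using neg[OF elim(1)] neg[OF elim(2)] elim by simp
    qed
    then obtain \<mu> where "good (c \<mu>) (e \<mu>)" using eventually_happens trivial_limit_at_right_real by blast
    then show ?thesis by (rule that)
  qed
  \<comment> \<open>Goodness holds for a whole interval of slopes, of which only countably many give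
    a non-transversal hit.\<close>
  obtain e where e: "good c e"
    and transv: "\<And>w. w \<in> {0..1} \<Longrightarrow> cross e (P w - c) = 0 \<Longrightarrow> w \<notin> E \<and> cross (D w) (P w - c) \<noteq> 0"
  proof -
    have "((\<lambda>\<theta>. Complex 1 \<theta> * e0) \<longlongrightarrow> Complex 1 0 * e0) (at 0)"
      by (intro tendsto_intros)
    moreover have "Complex 1 0 = 1" by (simp add: complex_eq_iff)
    ultimately have "eventually (\<lambda>\<theta>. good c (Complex 1 \<theta> * e0)) (at 0)"
      by (intro good_open[OF ce0] tendsto_const) simp
    then obtain \<delta> where \<delta>: "\<delta> > 0" "\<And>\<theta>. \<theta> \<noteq> 0 \<Longrightarrow> \<bar>\<theta>\<bar> < \<delta> \<Longrightarrow> good c (Complex 1 \<theta> * e0)"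
      unfolding eventually_at by (auto simp: dist_real_def)
    have "c \<notin> S" using ce0 by (simp add: good_def)
    moreover have "e0 \<noteq> 0" using ce0 by (auto simp: good_def)
    ultimately have cntbl: "countable {\<theta>. \<exists>u\<in>{0..1}. (u \<in> E \<or> cross (D u) (P u - c) = 0) \<and> cross (Complex 1 \<theta> * e0) (P u - c) = 0}"
      by (rule countable_critical_slopes)
    have "\<not> {0<..<\<delta>} \<subseteq> {\<theta>. \<exists>u\<in>{0..1}. (u \<in> E \<or> cross (D u) (P u - c) = 0) \<and> cross (Complex 1 \<theta> * e0) (P u - c) = 0}"
      (is "\<not> ?I \<subseteq> ?C")
    proof
      assume "?I \<subseteq> ?C"
      from countable_subset[OF this cntbl] show False using uncountable_open_interval[of 0 \<delta>] \<delta>(1) by simp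
    qed
    then obtain \<theta> where "\<theta> \<in> ?I" "\<theta> \<notin> ?C" by blast
    then have "\<And>u. u \<in> {0..1} \<Longrightarrow> cross (Complex 1 \<theta> * e0) (P u - c) = 0 \<Longrightarrow> u \<notin> E \<and> cross (D u) (P u - c) \<noteq> 0"
      by blast
    moreover have "good c (Complex 1 \<theta> * e0)" using \<delta>(2)[of \<theta>] \<open>\<theta> \<in> ?I\<close> by simp
    ultimately show ?thesis by (rule that[rotated])
  qed
  have cS: "c \<notin> S" and cm: "dist c m < \<rho>" and e_ne: "e \<noteq> 0" "norm e > 0" using e by (auto simp: good_def)
  obtain a k where k: "a > 0" "k = c - a *\<^sub>R e" "k \<in> S" "dist k x < \<rho>" using hits[OF e] by blast
  obtain p where p: "p \<in> S" "p \<in> closed_segment c k" "open_segment c p \<inter> S = {}" "dist p x < \<epsilon>'"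
    using \<rho>1(2)[of c k] k cm \<rho>(2) by auto
  obtain \<sigma> where \<sigma>: "0 \<le> \<sigma>" "p = (1 - \<sigma>) *\<^sub>R c + \<sigma> *\<^sub>R k" using p(2) by (auto simp: in_segment)
  define \<tau> where "\<tau> = \<sigma> * a"
  have p_eq: "p = c - \<tau> *\<^sub>R e" unfolding \<sigma>(2) k(2) \<tau>_def by (simp add: algebra_simps)
  have \<tau>: "\<tau> > 0"
  proof -
    have "p \<noteq> c" using p(1) cS by auto
    then have "\<tau> \<noteq> 0" using p_eq by auto
    moreover have "\<tau> \<ge> 0" using \<sigma>(1) k(1) by (simp add: \<tau>_def)
    ultimately show ?thesis by simp
  qed
  obtain s' where s': "s' \<in> {0..1}" "p = P s'" using p(1) by (auto simp: path_image_def)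
  have Ps: "P s' - c = (- \<tau>) *\<^sub>R e" using p_eq s'(2) by simp
  have "cross e (P s' - c) = 0" unfolding Ps by (simp only: cross_simps mult_zero_right)
  from transv[OF s'(1) this] have reg: "s' \<notin> E" "cross (D s') (P s' - c) \<noteq> 0" by auto
  have "cross (D s') (P s' - c) = (- \<tau>) * cross (D s') e" unfolding Ps by (simp only: cross_simps)
  moreover have "cross (D s') e = - cross e (D s')" by (simp add: cross_eq)
  ultimately have "cross e (D s') \<noteq> 0" using reg(2) by auto
  then obtain \<epsilon>2 \<kappa> where cone: "\<epsilon>2 > 0" "\<kappa> > 0"
    "\<And>z. z \<in> S \<Longrightarrow> dist p z < \<epsilon>2 \<Longrightarrow> \<kappa> * dist p z \<le> \<bar>cross e (z - p)\<bar>"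
    using transversal_cone[of s' e] s' reg(1) by (metis DiffI)
  have "closed_segment c p \<inter> S \<subseteq> {p}"
    using p(3) cS by (auto simp: closed_segment_eq_open)
  then obtain \<rho>3 where \<rho>3: "\<rho>3 > 0" "\<And>z q. z \<in> S \<Longrightarrow> q \<in> closed_segment c p \<Longrightarrow> dist z q < \<rho>3 \<Longrightarrow> dist z p < \<epsilon>2"
    using near_segment cone(1) by metis
  \<comment> \<open>The line turned about \<open>p\<close>. The slope \<open>\<eta> / \<tau>\<close>
    makes the point at position \<open>\<tau>\<close> move from \<open>c\<close> straight across the
    old line, by \<open>\<eta>\<close> times the length of \<open>e\<close>.\<close>
  define e' where "e' = (\<lambda>\<eta>. Complex 1 (\<eta> / \<tau>) * e)"
  define c' where "c' = (\<lambda>\<eta>. c + Complex 0 \<eta> * e)"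
  have c'p: "c' \<eta> = p + \<tau> *\<^sub>R e' \<eta>" for \<eta>
    unfolding p_eq c'_def e'_def using \<tau> by (simp add: complex_eq_iff algebra_simps)
  \<comment> \<open>A hit between \<open>p\<close> and \<open>c'\<close> would be close to the
    segment from \<open>c\<close> to \<open>p\<close>, hence close to \<open>p\<close>. There the
    cone demands a distance from the old line proportional to \<open>dist p z\<close>, which a small
    turn cannot reach; equality of the two rates occurs at
    \<open>\<bar>\<eta>\<bar> * norm e = \<kappa> * \<tau>\<close>.\<close>
  have near_free: "z = p" if \<eta>: "\<bar>\<eta>\<bar> * norm e < min \<rho>3 (\<kappa> * \<tau>)" and z: "z \<in> S" "z = p + r *\<^sub>R e' \<eta>" "0 \<le> r" "r \<le> \<tau>" for \<eta> r z
  proof (rule ccontr)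
    assume "z \<noteq> p"
    then have r: "r > 0" using z by (cases "r = 0") auto
    have "p + r *\<^sub>R e = (1 - (\<tau> - r) / \<tau>) *\<^sub>R c + ((\<tau> - r) / \<tau>) *\<^sub>R p"
      using \<tau> unfolding p_eq by (simp add: complex_eq_iff field_simps)
    then have q: "p + r *\<^sub>R e \<in> closed_segment c p"
      using r z(4) \<tau> unfolding in_segment by (intro exI[of _ "(\<tau> - r) / \<tau>"]) (auto simp: divide_le_eq_1)
    have "z - (p + r *\<^sub>R e) = Complex 0 (r * \<eta> / \<tau>) * e"
      unfolding z(2) e'_def by (simp add: complex_eq_iff algebra_simps)
    then have "dist z (p + r *\<^sub>R e) = \<bar>r * \<eta> / \<tau>\<bar> * norm e"
      unfolding dist_norm by (simp add: norm_mult complex_norm)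
    also have "\<dots> = (r / \<tau>) * (\<bar>\<eta>\<bar> * norm e)" using r \<tau> by (simp add: abs_mult)
    also have "\<dots> \<le> 1 * (\<bar>\<eta>\<bar> * norm e)" using z(4) \<tau> r by (intro mult_right_mono) (auto simp: divide_le_eq_1)
    finally have "dist z p < \<epsilon>2" using \<rho>3(2)[OF z(1) q] \<eta> by simp
    then have "\<kappa> * dist p z \<le> \<bar>cross e (z - p)\<bar>" using cone(3)[OF z(1)] by (simp add: dist_commute)
    moreover have zp: "z - p = Complex r (r * \<eta> / \<tau>) * e"
      unfolding z(2) e'_def by (simp add: complex_eq_iff algebra_simps)
    have "dist p z \<ge> r * norm e"
    proof -
      have "dist p z = norm (Complex r (r * \<eta> / \<tau>)) * norm e"
        by (metis dist_commute dist_norm norm_mult zp)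
      moreover have "r \<le> norm (Complex r (r * \<eta> / \<tau>))"
        using abs_Re_le_cmod[of "Complex r (r * \<eta> / \<tau>)"] by simp
      ultimately show ?thesis by (simp add: mult_right_mono)
    qed
    then have "\<kappa> * (r * norm e) \<le> \<kappa> * dist p z" using cone(2) by simp
    moreover have "\<bar>cross e (z - p)\<bar> = r * (\<bar>\<eta>\<bar> * norm e) / \<tau> * norm e"
      unfolding zp cross_mult_self using r \<tau> by (simp add: abs_mult power2_eq_square)
    ultimately have "\<kappa> * (r * norm e) \<le> r * (\<bar>\<eta>\<bar> * norm e) / \<tau> * norm e" by linarith
    then have "\<kappa> * \<tau> \<le> \<bar>\<eta>\<bar> * norm e" using r \<tau> e_ne by (simp add: field_simps)
    then show False using \<eta> by simp
  qed
  have "eventually (\<lambda>\<eta>. good (c' \<eta>) (e' \<eta>)) (at 0)"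
  proof (rule good_open[OF e])
    have "((\<lambda>\<eta>. c + Complex 0 \<eta> * e) \<longlongrightarrow> c + Complex 0 0 * e) (at 0)"
      "((\<lambda>\<eta>. Complex 1 (\<eta> / \<tau>) * e) \<longlongrightarrow> Complex 1 (0 / \<tau>) * e) (at 0)"
      using \<tau> by (intro tendsto_intros; simp)+
    moreover have "Complex 0 0 = 0" "Complex 1 0 = 1" by (simp_all add: complex_eq_iff)
    ultimately show "(c' \<longlongrightarrow> c) (at 0)" "(e' \<longlongrightarrow> e) (at 0)" by (simp_all add: c'_def e'_def)
  qed
  then obtain \<delta> where \<delta>: "\<delta> > 0" "\<And>\<eta>. \<eta> \<noteq> 0 \<Longrightarrow> \<bar>\<eta>\<bar> < \<delta> \<Longrightarrow> good (c' \<eta>) (e' \<eta>)"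
    unfolding eventually_at by (auto simp: dist_real_def)
  define \<delta>' where "\<delta>' = min \<delta> (min \<rho>3 (\<kappa> * \<tau>) / norm e)"
  have \<delta>': "\<delta>' > 0" using \<delta>(1) \<rho>3(1) cone(2) \<tau> e_ne by (simp add: \<delta>'_def)
  let ?T = "{t' \<in> {0..1}. dist (P t') (P t) < \<epsilon> \<and> P s' \<noteq> P t' \<and> open_segment (P s') (P t') \<inter> S = {}}"
  \<comment> \<open>The turn \<open>\<eta>\<close> can be read off from \<open>t'\<close> as
    \<open>\<tau>\<close> times the slope of \<open>P t' - p\<close> relative to \<open>e\<close>,
    so an interval of turns needs uncountably many \<open>t'\<close>.\<close>
  have "{0<..<\<delta>'} \<subseteq> (\<lambda>t'. \<tau> * (Im ((P t' - p) / e) / Re ((P t' - p) / e))) ` ?T"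
  proof
    fix \<eta> assume "\<eta> \<in> {0<..<\<delta>'}"
    then have \<eta>: "0 < \<eta>" "\<eta> < \<delta>" "\<bar>\<eta>\<bar> * norm e < min \<rho>3 (\<kappa> * \<tau>)"
      using e_ne by (auto simp: \<delta>'_def pos_less_divide_eq)
    have g: "good (c' \<eta>) (e' \<eta>)" using \<delta>(2)[of \<eta>] \<eta> by simp
    obtain b k' where k': "b > 0" "k' = c' \<eta> + b *\<^sub>R e' \<eta>" "k' \<in> S" "dist k' y < \<rho>" using hits[OF g] by blast
    have "dist (c' \<eta>) m < \<rho>2" using g \<rho>(3) by (auto simp: good_def)
    then obtain q where q: "q \<in> S" "q \<in> closed_segment (c' \<eta>) k'" "open_segment (c' \<eta>) q \<inter> S = {}" "dist q y < \<epsilon>'"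
      using \<rho>2(2)[of "c' \<eta>" k'] k' \<rho>(3) by auto
    obtain \<sigma>' where \<sigma>': "0 \<le> \<sigma>'" "q = (1 - \<sigma>') *\<^sub>R c' \<eta> + \<sigma>' *\<^sub>R k'" using q(2) by (auto simp: in_segment)
    define \<tau>' where "\<tau>' = \<sigma>' * b"
    have \<tau>': "\<tau>' \<ge> 0" using \<sigma>'(1) k'(1) by (simp add: \<tau>'_def)
    have q_c: "q = c' \<eta> + \<tau>' *\<^sub>R e' \<eta>" unfolding \<sigma>'(2) k'(2) \<tau>'_def by (simp add: algebra_simps)
    then have q_eq: "q - p = (\<tau> + \<tau>') *\<^sub>R e' \<eta>" unfolding c'p by (simp add: algebra_simps)
    have e'0: "e' \<eta> \<noteq> 0" using e_ne by (simp add: e'_def Complex_eq_0)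
    have pq: "p \<noteq> q" using q_eq e'0 \<tau> \<tau>' by auto
    obtain t' where t': "t' \<in> {0..1}" "q = P t'" using q(1) by (auto simp: path_image_def)
    \<comment> \<open>The segment is split at \<open>c' \<eta>\<close>: \<open>near_free\<close>
      clears the part from \<open>p\<close>, and the choice of \<open>q\<close> as first hit clears
      the rest.\<close>
    have free: "z \<notin> S" if "z \<in> open_segment p q" for z
    proof
      assume "z \<in> S"
      obtain r where r: "0 < r" "r < 1" "z = p + (r * (\<tau> + \<tau>')) *\<^sub>R e' \<eta>"
      proof -
        obtain r where "0 < r" "r < 1" "z = (1 - r) *\<^sub>R p + r *\<^sub>R q" using \<open>z \<in> open_segment p q\<close> by (auto simp: in_segment)
        moreover have "(1 - r) *\<^sub>R p + r *\<^sub>R q = p + r *\<^sub>R (q - p)" by (simp add: algebra_simps)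
        ultimately show ?thesis using that[of r] q_eq by simp
      qed
      show False
      proof (cases "r * (\<tau> + \<tau>') \<le> \<tau>")
        case True
        have "r * (\<tau> + \<tau>') > 0" using r \<tau> \<tau>' by simp
        then have "z = p" using near_free[OF \<eta>(3) \<open>z \<in> S\<close> r(3)] True by simp
        then show False using r \<tau> \<tau>' e'0 by simp
      next
        case False
        define \<omega> where "\<omega> = (r * (\<tau> + \<tau>') - \<tau>) / \<tau>'"
        have "r * (\<tau> + \<tau>') < \<tau> + \<tau>'" using r \<tau> \<tau>' by (simp add: mult_less_cancel_right1)
        then have \<tau>'0: "\<tau>' > 0" using False \<tau>' by (cases "\<tau>' = 0") auto
        have \<omega>: "0 < \<omega>" "\<omega> < 1" using False \<open>r * (\<tau> + \<tau>') < \<tau> + \<tau>'\<close> \<tau>'0 by (auto simp: \<omega>_def)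
        have "z = c' \<eta> + (\<omega> * \<tau>') *\<^sub>R e' \<eta>"
        proof -
          have "r * (\<tau> + \<tau>') = \<tau> + \<omega> * \<tau>'" using \<tau>'0 by (simp add: \<omega>_def)
          then show ?thesis unfolding r(3) c'p by (simp only: scaleR_left_distrib add.assoc)
        qed
        then have "z = (1 - \<omega>) *\<^sub>R c' \<eta> + \<omega> *\<^sub>R q" unfolding q_c by (simp add: algebra_simps)
        moreover have "c' \<eta> \<noteq> q" unfolding q_c using \<tau>'0 e'0 by simp
        ultimately have "z \<in> open_segment (c' \<eta>) q" using \<omega> by (auto simp: in_segment)
        then show False using q(3) \<open>z \<in> S\<close> by blast
      qed
    qed
    have "dist (P t') (P t) < \<epsilon>" using q(4) t'(2) by (simp add: \<epsilon>'_def y_def)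
    then have "t' \<in> ?T" using t' s'(2) pq free by auto
    moreover have "\<eta> = \<tau> * (Im ((P t' - p) / e) / Re ((P t' - p) / e))"
    proof -
      have "(P t' - p) / e = (\<tau> + \<tau>') *\<^sub>R Complex 1 (\<eta> / \<tau>)"
        using q_eq e_ne t'(2) by (simp add: e'_def scaleR_conv_of_real)
      then show ?thesis using \<tau> \<tau>' by simp
    qed
    ultimately show "\<eta> \<in> (\<lambda>t'. \<tau> * (Im ((P t' - p) / e) / Re ((P t' - p) / e))) ` ?T" by (rule rev_image_eqI)
  qed
  note cover = this
  have "uncountable ?T"
  proof
    assume "countable ?T"
    from countable_subset[OF cover countable_image[OF this]]
    show False using uncountable_open_interval[of 0 \<delta>'] \<delta>' by simp
  qed
  moreover have "dist (P s') (P s) < \<epsilon>" using p(4) s'(2) by (simp add: \<epsilon>'_def x_def)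
  ultimately show ?thesis using that s'(1) by blast
qed

end

subsection \<open>Comparing the two curves\<close>

context curved_loop
begin

lemma inside_midpoint_stable:
  assumes "midpoint x y \<notin> S"
  obtains \<epsilon> where "\<epsilon> > 0" "\<And>x' y'. dist x' x < \<epsilon> \<Longrightarrow> dist y' y < \<epsilon> \<Longrightarrow>
    midpoint x' y' \<in> inside S \<longleftrightarrow> midpoint x y \<in> inside S"
proof -
  obtain \<epsilon> where \<epsilon>: "\<epsilon> > 0" "ball (midpoint x y) \<epsilon> \<subseteq> - S"
    using assms closed_S open_contains_ball[of "- S"] by (metis ComplI open_Compl)
  show ?thesis
  proof (rule that[OF \<epsilon>(1)])
    fix x' y' assume d: "dist x' x < \<epsilon>" "dist y' y < \<epsilon>"
    have "midpoint x y - midpoint x' y' = (1/2) *\<^sub>R (x - x') + (1/2) *\<^sub>R (y - y')"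
      by (simp add: midpoint_def algebra_simps)
    then have "dist (midpoint x y) (midpoint x' y') \<le> dist x' x / 2 + dist y' y / 2"
      using norm_triangle_ineq[of "(1/2) *\<^sub>R (x - x')" "(1/2) *\<^sub>R (y - y')"]
      by (simp add: dist_norm norm_minus_commute)
    then have "midpoint x' y' \<in> ball (midpoint x y) \<epsilon>" using d by simp
    then show "midpoint x' y' \<in> inside S \<longleftrightarrow> midpoint x y \<in> inside S"
      using \<epsilon> by (intro inside_const[of "ball (midpoint x y) \<epsilon>"]) auto
  qed
qed

lemma I_edge_iff_midpoint:
  assumes "P s \<noteq> P t" "Body P (P s) (P t) = 0" "open_segment (P s) (P t) \<inter> S = {}"
  shows "I_edge P s t \<longleftrightarrow> midpoint (P s) (P t) \<in> inside S"
proof -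
  have mid: "midpoint (P s) (P t) \<in> open_segment (P s) (P t)" using assms(1) by simp
  have "z \<in> inside S \<longleftrightarrow> midpoint (P s) (P t) \<in> inside S" if "z \<in> open_segment (P s) (P t)" for z
    by (rule inside_const[OF _ assms(3) that mid]) (simp add: convex_connected)
  then have "open_segment (P s) (P t) \<subseteq> inside S \<longleftrightarrow> midpoint (P s) (P t) \<in> inside S"
    using mid by blast
  then show ?thesis
    using assms(2) by (simp add: I_edge_def visibility_edge_def B_info_def zero_parity_of_def)
qed

text \<open>The right-hand side does not mention \<open>P\<close>, so equality of points transfers
  between the two curves.\<close>

lemma P_eq_iff_param:
  assumes "u \<in> {0..1}" "v \<in> {0..1}"
  shows "P u = P v \<longleftrightarrow> u = v \<or> u = 0 \<and> v = 1 \<or> u = 1 \<and> v = 0"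
  using P_eqD[OF _ assms] P01 by auto

text \<open>\<open>Q\<close> is continuous as a function of the point \<open>P u\<close>.
  Compactness is used as in \<open>near_parameter\<close>, but \<open>s\<close> may be the seam,
  since \<open>Q\<close> takes the same value at 0 and 1.\<close>

lemma close_param_close_image:
  assumes Q: "continuous_on {0..1} Q" "Q 1 = Q 0" and s: "s \<in> {0..1}" and "\<epsilon> > 0"
  obtains \<delta> where "\<delta> > 0" "\<And>u. u \<in> {0..1} \<Longrightarrow> dist (P u) (P s) < \<delta> \<Longrightarrow> dist (Q u) (Q s) < \<epsilon>"
proof -
  define K where "K = {u \<in> {0..1}. \<epsilon> \<le> dist (Q u) (Q s)}"
  have "closed K" unfolding K_def
    by (intro continuous_on_closed_Collect_le continuous_intros Q)
  then have "compact K" unfolding compact_eq_bounded_closed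
    by (auto simp: K_def intro: bounded_subset[of "{0..1::real}"])
  then have "compact (P ` K)"
    by (intro compact_continuous_image continuous_on_subset[OF continuous_P]) (auto simp: K_def)
  moreover have "P s \<notin> P ` K"
  proof
    assume "P s \<in> P ` K"
    then obtain u where u: "u \<in> K" "P u = P s" by force
    then have "Q u = Q s" using P_eq_iff_param[of u s] s Q(2) by (auto simp: K_def)
    then show False using u(1) \<open>\<epsilon> > 0\<close> by (simp add: K_def)
  qed
  ultimately obtain \<delta> where \<delta>: "\<delta> > 0" "\<And>z. z \<in> P ` K \<Longrightarrow> \<delta> \<le> dist (P s) z"
    using separate_point_closed compact_imp_closed by metis
  show ?thesis
  proof (rule that[OF \<delta>(1)])
    fix u assume "u \<in> {0..1}" "dist (P u) (P s) < \<delta>"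
    then show "dist (Q u) (Q s) < \<epsilon>" using \<delta>(2)[of "P u"] by (force simp: K_def dist_commute)
  qed
qed

end

lemma zero_parity_of_eq_zero: "zero_parity_of n = ZP_zero \<longleftrightarrow> n = 0"
  by (simp add: zero_parity_of_def)

lemma zero_parity_of_eq_odd: "zero_parity_of n = ZP_odd \<longleftrightarrow> odd n"
  by (auto simp: zero_parity_of_def intro: odd_pos)

theorem mainTheorem3:
  fixes P Q :: "real \<Rightarrow> complex" and s t :: real
  assumes "admissible_curve P" and "admissible_curve Q"
    and "same_ZP_info P Q"
    and "s \<in> {0..1}" and "t \<in> {0..1}" and "P s \<noteq> P t"
    and "B_info P s t = ZP_zero"
  shows "I_edge P s t \<longleftrightarrow> I_edge Q s t"
proof -
  obtain E D D2 where "tame_loop P E D D2" using assms(1) by (rule admissible_curve_tame_loop)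
  then interpret P: tame_loop P E D D2 .
  obtain E' D' D2' where "tame_loop Q E' D' D2'" using assms(2) by (rule admissible_curve_tame_loop)
  then interpret Q: tame_loop Q E' D' D2' .
  have distinct: "P u \<noteq> P v \<longleftrightarrow> Q u \<noteq> Q v" if "u \<in> {0..1}" "v \<in> {0..1}" for u v
    using P.P_eq_iff_param[OF that] Q.P_eq_iff_param[OF that] by simp
  have visible: "open_segment (Q u) (Q v) \<inter> path_image Q = {}"
    "even (Head P (P u) (P v)) \<longleftrightarrow> even (Head Q (Q u) (Q v))"
    "Body P (P u) (P v) = 0" "Body Q (Q u) (Q v) = 0"
    if uv: "u \<in> {0..1}" "v \<in> {0..1}" "P u \<noteq> P v" and vis: "open_segment (P u) (P v) \<inter> path_image P = {}" for u v
  proof -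
    have neQ: "Q u \<noteq> Q v" using distinct uv by blast
    have same: "B_info P u v = B_info Q u v" "H_info P u v = H_info Q u v"
      using assms(3) uv neQ unfolding same_ZP_info_def by blast+
    show B0: "Body P (P u) (P v) = 0" using P.visible_iff uv(3) vis by blast
    then show B: "Body Q (Q u) (Q v) = 0"
      using same(1) by (metis B_info_def zero_parity_of_eq_zero)
    then show "open_segment (Q u) (Q v) \<inter> path_image Q = {}" using Q.visible_iff neQ by blast
    show "even (Head P (P u) (P v)) \<longleftrightarrow> even (Head Q (Q u) (Q v))"
      using same(2) by (metis H_info_def zero_parity_of_eq_odd)
  qed
  have visP: "open_segment (P s) (P t) \<inter> path_image P = {}"
    using assms(6,7) P.visible_iff by (simp add: B_info_def zero_parity_of_eq_zero)
  note visQ = visible[OF assms(4-6) visP]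
  have neQ: "Q s \<noteq> Q t" using distinct assms(4-6) by blast
  have "midpoint (P s) (P t) \<in> open_segment (P s) (P t)" "midpoint (Q s) (Q t) \<in> open_segment (Q s) (Q t)"
    using assms(6) neQ by simp_all
  with visP visQ(1) have mid: "midpoint (P s) (P t) \<notin> path_image P" "midpoint (Q s) (Q t) \<notin> path_image Q"
    by blast+
  obtain \<epsilon>P where \<epsilon>P: "\<epsilon>P > 0" "\<And>x y. dist x (P s) < \<epsilon>P \<Longrightarrow> dist y (P t) < \<epsilon>P \<Longrightarrow>
      midpoint x y \<in> inside (path_image P) \<longleftrightarrow> midpoint (P s) (P t) \<in> inside (path_image P)"
    by (rule P.inside_midpoint_stable[OF mid(1)]) blast
  obtain \<epsilon>Q where \<epsilon>Q: "\<epsilon>Q > 0" "\<And>x y. dist x (Q s) < \<epsilon>Q \<Longrightarrow> dist y (Q t) < \<epsilon>Q \<Longrightarrow>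
      midpoint x y \<in> inside (path_image Q) \<longleftrightarrow> midpoint (Q s) (Q t) \<in> inside (path_image Q)"
    by (rule Q.inside_midpoint_stable[OF mid(2)]) blast
  obtain \<delta>s where \<delta>s: "\<delta>s > 0" "\<And>u. u \<in> {0..1} \<Longrightarrow> dist (P u) (P s) < \<delta>s \<Longrightarrow> dist (Q u) (Q s) < \<epsilon>Q"
    by (rule P.close_param_close_image[OF Q.continuous_P Q.P01 assms(4) \<epsilon>Q(1)]) blast
  obtain \<delta>t where \<delta>t: "\<delta>t > 0" "\<And>u. u \<in> {0..1} \<Longrightarrow> dist (P u) (P t) < \<delta>t \<Longrightarrow> dist (Q u) (Q t) < \<epsilon>Q"
    by (rule P.close_param_close_image[OF Q.continuous_P Q.P01 assms(5) \<epsilon>Q(1)]) blast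
  \<comment> \<open>Small enough that the perturbation keeps the side of the midpoint for
    \<open>P\<close> and, through the common parameters, for \<open>Q\<close>.\<close>
  define \<epsilon> where "\<epsilon> = min \<epsilon>P (min \<delta>s \<delta>t)"
  have "\<epsilon> > 0" using \<epsilon>P \<delta>s(1) \<delta>t(1) by (simp add: \<epsilon>_def)
  obtain s' where s': "s' \<in> {0..1}" "dist (P s') (P s) < \<epsilon>"
    "uncountable {t' \<in> {0..1}. dist (P t') (P t) < \<epsilon> \<and> P s' \<noteq> P t' \<and> open_segment (P s') (P t') \<inter> path_image P = {}}"
    (is "uncountable ?T")
    by (rule P.uncountably_many_visible_nearby[OF assms(4-6) visP \<open>\<epsilon> > 0\<close>]) blast
  \<comment> \<open>The pair was perturbed using \<open>P\<close> alone; genericity for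
    \<open>Q\<close> at the same \<open>s'\<close> costs only another countable set of
    \<open>t'\<close>.\<close>
  have "countable (P.nongeneric s' \<union> Q.nongeneric s')"
    using P.countable_nongeneric Q.countable_nongeneric by simp
  from countable_subset[OF _ this] have "\<not> ?T \<subseteq> P.nongeneric s' \<union> Q.nongeneric s'"
    using s'(3) by (rule contrapos_nn[rotated])
  then obtain t' where "t' \<in> ?T" and gen: "t' \<notin> P.nongeneric s'" "t' \<notin> Q.nongeneric s'" by blast
  then have t': "t' \<in> {0..1}" "dist (P t') (P t) < \<epsilon>" "P s' \<noteq> P t'"
    and visP': "open_segment (P s') (P t') \<inter> path_image P = {}" by blast+
  note visQ' = visible[OF s'(1) t'(1,3) visP']
  have "I_edge P s t \<longleftrightarrow> midpoint (P s) (P t) \<in> inside (path_image P)"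
    by (rule P.I_edge_iff_midpoint[OF assms(6) visQ(3) visP])
  also have "\<dots> \<longleftrightarrow> midpoint (P s') (P t') \<in> inside (path_image P)"
    using \<epsilon>P(2)[of "P s'" "P t'"] s'(2) t'(2) by (simp add: \<epsilon>_def)
  also have "\<dots> \<longleftrightarrow> even (Head P (P s') (P t'))"
    by (rule P.generic_parity[OF s'(1) t'(1) gen(1) t'(3) visP'])
  also have "\<dots> \<longleftrightarrow> even (Head Q (Q s') (Q t'))" by (rule visQ'(2))
  also have "\<dots> \<longleftrightarrow> midpoint (Q s') (Q t') \<in> inside (path_image Q)"
    using Q.generic_parity[OF s'(1) t'(1) gen(2) _ visQ'(1)] distinct[OF s'(1) t'(1)] t'(3) by blast
  also have "\<dots> \<longleftrightarrow> midpoint (Q s) (Q t) \<in> inside (path_image Q)"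
    using \<epsilon>Q(2)[of "Q s'" "Q t'"] \<delta>s(2)[OF s'(1)] \<delta>t(2)[OF t'(1)] s'(2) t'(2) by (simp add: \<epsilon>_def)
  also have "\<dots> \<longleftrightarrow> I_edge Q s t"
    by (rule Q.I_edge_iff_midpoint[OF neQ visQ(4) visQ(1), symmetric])
  finally show ?thesis .
qed

end
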